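(* Let $\mathcal{D}_n$ be the set of connected $(2,3)$-valent combinatorial maps with $n$ edges, namely pairs $(v,e)$ of permutations of the half-edge set $\{1,\dots,2n\}$ such that every cycle of $v$ has length $2$ or $3$, $e$ is a fixed-point-free involution, and $\langle v,e\rangle$ acts transitively. Let $X^{bi}_n$ be the number of vertices of degree $2$ (2-cycles of $v$) of a uniformly random element of $\mathcal{D}_n$. Then the mean and variance of $X^{bi}_n$ are asymptotically $\mu_n=\sigma_n^2=\frac{(2n)^{2/3}}{2}$, and $$\frac{X^{bi}_n - \mu_n}{\sqrt{\sigma_n^2}} \xrightarrow{D} \mathcal{N}(0,1).$$
   Context: In a combinatorial map $(v,e)$, vertices are the cycles of $v$, and the degree of a vertex is the length of its cycle. Edges are the cycles of $e$.
   Formalization: The limit law is centred and scaled by the exact mean and variance of X_n (each asymptotic to (2n)^{2/3}/2), not by (2n)^{2/3}/2 itself: the mean is (2n)^{2/3}/2 − (2n)^{1/3}/3 + o(n^{1/3}), so the literal centring gives the limit N(−√2/3, 1). *)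

theory Defs
  imports
    "HOL-Probability.Probability"
    "HOL-Library.Landau_Symbols"
    "HOL-Combinatorics.Orbits"
    "HOL-Algebra.Sym_Groups"
    "HOL-Algebra.Generated_Groups"
begin

(* For a permutation p of A, the set orbit p x is the support of the cycle of p through x
   (fixed points give cycles of length 1), so the length of the cycle is its cardinality. *)
definition cycles_on :: "('a \<Rightarrow> 'a) \<Rightarrow> 'a set \<Rightarrow> 'a set set" where
  "cycles_on p A = orbit p ` A"

(* The carrier of sym_group (2 * n) consists of the permutations of the half-edges {1..2 * n}. *)
definition connected_23_maps :: "nat \<Rightarrow> ((nat \<Rightarrow> nat) \<times> (nat \<Rightarrow> nat)) set" where
  "connected_23_maps n =
     {(v, e). v \<in> carrier (sym_group (2 * n)) \<and> e \<in> carrier (sym_group (2 * n)) \<and>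
        (\<forall>c \<in> cycles_on v {1..2 * n}. card c = 2 \<or> card c = 3) \<and>
        (\<forall>x \<in> {1..2 * n}. e x \<noteq> x \<and> e (e x) = x) \<and>
        (\<forall>x \<in> {1..2 * n}. \<forall>y \<in> {1..2 * n}.
           \<exists>g \<in> generate (sym_group (2 * n)) {v, e}. g x = y)}"

definition bivalent_vertices :: "nat \<Rightarrow> (nat \<Rightarrow> nat) \<times> (nat \<Rightarrow> nat) \<Rightarrow> nat set set" where
  "bivalent_vertices n m = {c \<in> cycles_on (fst m) {1..2 * n}. card c = 2}"

definition X_bi :: "nat \<Rightarrow> (nat \<Rightarrow> nat) \<times> (nat \<Rightarrow> nat) \<Rightarrow> real" where
  "X_bi n m = real (card (bivalent_vertices n m))"

(* connected_23_maps n is finite and nonempty for every n, so this is the uniform distribution. *)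
definition random_map :: "nat \<Rightarrow> ((nat \<Rightarrow> nat) \<times> (nat \<Rightarrow> nat)) pmf" where
  "random_map n = pmf_of_set (connected_23_maps n)"

definition mean_bi :: "nat \<Rightarrow> real" where
  "mean_bi n = measure_pmf.expectation (random_map n) (X_bi n)"

definition variance_bi :: "nat \<Rightarrow> real" where
  "variance_bi n = measure_pmf.variance (random_map n) (X_bi n)"

(* The limit law is centred at the mean itself, of which (2n)^(2/3) / 2 is only the leading term:
   the mean is (2n)^(2/3) / 2 - (2n)^(1/3) / 3 + o(n^(1/3)), and its second term has the order of
   the standard deviation, so centring at the leading term would give the limit
   N(-sqrt 2 / 3, 1). *)
definition normalized_bi :: "nat \<Rightarrow> (nat \<Rightarrow> nat) \<times> (nat \<Rightarrow> nat) \<Rightarrow> real" where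
  "normalized_bi n m = (X_bi n m - mean_bi n) / sqrt (variance_bi n)"

end

theory Submission
  imports Defs "HOL-Real_Asymp.Real_Asymp"
begin

text \<open>
  Drop connectedness and let \<open>(v, e)\<close> be uniform among all pairs, so that the number \<open>k\<close> of 2-cycles
  depends on \<open>v\<close> only and has weights proportional to \<open>1 / (2^k k! 3^t t!)\<close> with \<open>2k + 3t = 2n\<close>.
  The ratio of consecutive weights gives the Stein identity
  \<open>E[2k(k-1)(k-2) f(k-3)] = E[(n-k)(n-k-3/2) f(k)]\<close>. Centre \<open>k\<close> at the point \<open>r^2\<close> where the leading
  terms \<open>2 r^6\<close> and \<open>n^2 - 2 n r^2\<close> of the two coefficients balance, and scale by \<open>r\<close>: for
  \<open>Y = (k - r^2) / r\<close> the identity reads \<open>E[Y f(Y)] = E[f'(Y)] + O(1/r)\<close> as soon as \<open>E[Y^4]\<close> is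
  bounded, which the choice \<open>f(y) = y^3\<close> shows. The choices \<open>1\<close>, \<open>y\<close> and \<open>exp(i t y)\<close> then give the
  mean, the variance and the differential equation \<open>\<phi>'(t) = -t \<phi>(t) + o(1)\<close> of the Gaussian
  characteristic function.

  A disconnected pair leaves a proper nonempty set of half-edges invariant; the union bound over such
  sets is a convolution sum of pair counts, whose growth is known from the mean just computed, and it
  tends to 0. Conditioning on connectedness hence does not change the limit law, nor, by
  Cauchy--Schwarz and the fourth moment, the first two moments.
\<close>

subsection \<open>Counting permutations by cycle type\<close>

text \<open>The centre must be right up to o(n^(1/3)), because the standard deviation has order
  n^(1/3). With r of that order, the two coefficients of the Stein identity at k = r^2 have terms of
  orders r^6, r^5, r^4 and lower. The equation for r cancels orders r^6 and r^5 exactly; what is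
  left has order r^4 and competes with a slope 6 r^5 per unit of y, hence the error 1/r. Dropping
  the term 2 n r^2 would move the centre by a constant multiple of r. No asymptotic expansion is
  made: the coefficients are exact polynomials in y, u = 1/r and v = n/r^3. Their remainders are
  cubic in y, so multiplied by y they have degree four, which is why the fourth moment is required.
  That moment cannot be had from the same crude bounds, since y^3 times a cubic has degree six; it
  rests on a pointwise inequality using the signs of the exact coefficients and k >= 0. The shift by
  3 is forced by parity: in 2k + 3t = 2n the number t is even, so the smallest move trades three
  2-cycles for two 3-cycles.\<close>

definition perms23 :: "'a set \<Rightarrow> ('a \<Rightarrow> 'a) set" where
  "perms23 A = {v. v permutes A \<and> (\<forall>c \<in> cycles_on v A. card c = 2 \<or> card c = 3)}"

definition num_cycles :: "('a \<Rightarrow> 'a) \<Rightarrow> 'a set \<Rightarrow> nat \<Rightarrow> nat" where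
  "num_cycles v A j = card {c \<in> cycles_on v A. card c = j}"

definition perms_type :: "'a set \<Rightarrow> nat \<Rightarrow> nat \<Rightarrow> ('a \<Rightarrow> 'a) set" where
  "perms_type A k t = {v \<in> perms23 A. num_cycles v A 2 = k \<and> num_cycles v A 3 = t}"

definition matchings :: "'a set \<Rightarrow> ('a \<Rightarrow> 'a) set" where
  "matchings A = {e. e permutes A \<and> (\<forall>x \<in> A. e x \<noteq> x \<and> e (e x) = x)}"

lemma finite_perms23: "finite A \<Longrightarrow> finite (perms23 A)"
  by (rule finite_subset[OF _ finite_permutations[of A]]) (auto simp: perms23_def)

lemma finite_perms_type: "finite A \<Longrightarrow> finite (perms_type A k t)"
  by (rule finite_subset[OF _ finite_perms23[of A]]) (auto simp: perms_type_def)

lemma finite_matchings: "finite A \<Longrightarrow> finite (matchings A)"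
  by (rule finite_subset[OF _ finite_permutations[of A]]) (auto simp: matchings_def)

lemma self_in_orbit_permutes: "v permutes A \<Longrightarrow> finite A \<Longrightarrow> x \<in> orbit v x"
  by (metis permutation_permutes permutation_self_in_orbit)

lemma cycles_on_subset: "v permutes A \<Longrightarrow> c \<in> cycles_on v A \<Longrightarrow> c \<subseteq> A"
  using permutes_orbit_subset by (fastforce simp: cycles_on_def)

lemma finite_cycles_on: "finite A \<Longrightarrow> finite (cycles_on v A)"
  by (simp add: cycles_on_def)

section \<open>Permutations composed of two parts with disjoint supports\<close>

lemma orbit_comp_disjoint:
  assumes "p permutes B" "q permutes C" "B \<inter> C = {}"
  shows "x \<in> B \<Longrightarrow> orbit (p \<circ> q) x = orbit p x" "x \<in> C \<Longrightarrow> orbit (p \<circ> q) x = orbit q x"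
proof -
  have 1: "(p \<circ> q) y = p y" if "y \<in> B" for y
    using assms that by (metis comp_apply disjoint_iff permutes_not_in)
  have 2: "(p \<circ> q) y = q y" if "y \<in> C" for y
  proof -
    have "q y \<notin> B" using that assms(3) permutes_in_image[OF assms(2), of y] by auto
    then show ?thesis using permutes_not_in[OF assms(1)] by simp
  qed
  have 3: "p \<circ> q \<in> B \<rightarrow> B"
    by (rule Pi_I) (simp only: 1 permutes_in_image[OF assms(1)])
  have 4: "p \<circ> q \<in> C \<rightarrow> C"
    by (rule Pi_I) (simp only: 2 permutes_in_image[OF assms(2)])
  show "x \<in> B \<Longrightarrow> orbit (p \<circ> q) x = orbit p x"
    by (rule orbit_cong0[OF _ 3 1])
  show "x \<in> C \<Longrightarrow> orbit (p \<circ> q) x = orbit q x"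
    by (rule orbit_cong0[OF _ 4 2])
qed

lemma cycles_on_comp:
  assumes "p permutes B" "q permutes C" "B \<inter> C = {}"
  shows "cycles_on (p \<circ> q) (B \<union> C) = cycles_on p B \<union> cycles_on q C"
  unfolding cycles_on_def image_Un
  by (intro arg_cong2[where f = "(\<union>)"] image_cong orbit_comp_disjoint[OF assms] refl)

lemma cycles_on_disjoint:
  assumes "p permutes B" "q permutes C" "B \<inter> C = {}"
  shows "cycles_on p B \<inter> cycles_on q C = {}"
proof -
  have "c \<noteq> {}" if "c \<in> cycles_on p B" for c
    using that by (auto simp: cycles_on_def orbit_nonempty)
  then show ?thesis
    using cycles_on_subset[OF assms(1)] cycles_on_subset[OF assms(2)] assms(3) by blast
qed

lemma perms23_comp_iff:
  assumes "p permutes B" "q permutes C" "B \<inter> C = {}"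
  shows "p \<circ> q \<in> perms23 (B \<union> C) \<longleftrightarrow> p \<in> perms23 B \<and> q \<in> perms23 C"
proof -
  have "p \<circ> q permutes (B \<union> C)"
    using assms by (meson permutes_compose permutes_subset sup_ge1 sup_ge2)
  then show ?thesis using assms by (auto simp: perms23_def cycles_on_comp)
qed

lemma num_cycles_comp:
  assumes "p permutes B" "q permutes C" "B \<inter> C = {}" "finite B" "finite C"
  shows "num_cycles (p \<circ> q) (B \<union> C) j = num_cycles p B j + num_cycles q C j"
proof -
  have "{c \<in> cycles_on (p \<circ> q) (B \<union> C). card c = j} =
        {c \<in> cycles_on p B. card c = j} \<union> {c \<in> cycles_on q C. card c = j}"
    using cycles_on_comp[OF assms(1-3)] by auto
  then show ?thesis
    unfolding num_cycles_def
    using cycles_on_disjoint[OF assms(1-3)] finite_cycles_on assms(4,5)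
    by (simp, subst card_Un_disjoint) auto
qed

text \<open>An injective self-map of a finite set is onto, so the inclusion already makes B and its
  complement exactly invariant. This one splitting serves both to peel off a single cycle and to cut
  a disconnected pair in two.\<close>

lemma perm_restrict_invariant:
  assumes "v permutes A" "finite A" "B \<subseteq> A" "v ` B \<subseteq> B"
  shows "perm_restrict v B permutes B" "perm_restrict v (A - B) permutes (A - B)"
    "perm_restrict v B \<circ> perm_restrict v (A - B) = v"
proof -
  have fin: "finite B" using assms finite_subset by blast
  have inj: "inj v" using assms(1) by (rule permutes_inj)
  have eq: "v ` B = B"
    using endo_inj_surj[OF fin assms(4)] inj by (simp add: inj_on_def)
  show B: "perm_restrict v B permutes B"
  proof (rule bij_imp_permutes)
    have "bij_betw v B B" unfolding bij_betw_def using eq inj inj_on_subset by blast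
    then show "bij_betw (perm_restrict v B) B B"
      by (subst bij_betw_cong[where g = v]) (simp_all add: perm_restrict_simps)
  qed (simp add: perm_restrict_simps)
  have eq2: "v ` (A - B) = A - B"
    using eq assms(1) inj by (metis image_set_diff permutes_image)
  show C: "perm_restrict v (A - B) permutes (A - B)"
  proof (rule bij_imp_permutes)
    have "bij_betw v (A - B) (A - B)" unfolding bij_betw_def using eq2 inj inj_on_subset by blast
    then show "bij_betw (perm_restrict v (A - B)) (A - B) (A - B)"
      by (subst bij_betw_cong[where g = v]) (simp_all add: perm_restrict_simps)
  qed (simp add: perm_restrict_simps)
  have "perm_restrict v B \<circ> perm_restrict v (A - B) = perm_restrict v (B \<union> (A - B))"
    by (rule perm_restrict_union[OF B C]) auto
  also have "B \<union> (A - B) = A" using assms(3) by auto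
  also have "perm_restrict v A = v" using assms(1) by (rule perm_restrict_id)
  finally show "perm_restrict v B \<circ> perm_restrict v (A - B) = v" .
qed

section \<open>Peeling off the cycle through a given point\<close>

definition cycle3 :: "'a \<Rightarrow> 'a \<Rightarrow> 'a \<Rightarrow> 'a \<Rightarrow> 'a" where
  "cycle3 x y z = Transposition.transpose x y \<circ> Transposition.transpose y z"

lemma cycle3_apply:
  assumes "x \<noteq> y" "x \<noteq> z" "y \<noteq> z"
  shows "cycle3 x y z x = y" "cycle3 x y z y = z" "cycle3 x y z z = x"
    "w \<notin> {x, y, z} \<Longrightarrow> cycle3 x y z w = w"
  using assms by (auto simp: cycle3_def Transposition.transpose_def)

lemma cycle3_permutes: "cycle3 x y z permutes {x, y, z}"
  unfolding cycle3_def by (intro permutes_compose permutes_swap_id) auto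

lemma orbit_card_2:
  assumes "v permutes A" "finite A" "card (orbit v x) = 2"
  shows "v x \<noteq> x" "v (v x) = x" "orbit v x = {x, v x}"
proof -
  note inj = permutes_inj[OF assms(1), THEN injD]
  have mem: "x \<in> orbit v x" "v x \<in> orbit v x" "v (v x) \<in> orbit v x"
    using self_in_orbit_permutes[OF assms(1,2)] by (auto intro: orbit.intros)
  show ne: "v x \<noteq> x"
  proof
    assume "v x = x"
    then have "orbit v x = {x}" by (simp add: orbit_eq_singleton_iff)
    then show False using assms(3) by simp
  qed
  have "finite (orbit v x)" using assms(3) by (metis card.infinite zero_neq_numeral)
  then have "{x, v x} = orbit v x"
    by (rule card_subset_eq) (use mem ne assms(3) in auto)
  then show eq: "orbit v x = {x, v x}" by simp
  show "v (v x) = x" using mem(3) ne inj[of "v x" x] unfolding eq by auto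
qed

lemma orbit_card_3:
  assumes "v permutes A" "finite A" "card (orbit v x) = 3"
  shows "v x \<noteq> x" "v (v x) \<noteq> x" "v (v x) \<noteq> v x" "v (v (v x)) = x"
    "orbit v x = {x, v x, v (v x)}"
proof -
  note inj = permutes_inj[OF assms(1), THEN injD]
  have mem: "x \<in> orbit v x" "v x \<in> orbit v x" "v (v x) \<in> orbit v x" "v (v (v x)) \<in> orbit v x"
    using self_in_orbit_permutes[OF assms(1,2)] by (auto intro: orbit.intros)
  show ne: "v x \<noteq> x"
  proof
    assume "v x = x"
    then have "orbit v x = {x}" by (simp add: orbit_eq_singleton_iff)
    then show False using assms(3) by simp
  qed
  show ne2: "v (v x) \<noteq> x"
  proof
    assume "v (v x) = x"
    then have "(v ^^ 2) x = x" by (simp add: numeral_2_eq_2)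
    then have "orbit v x = {(v ^^ m) x |m. m < 2}" by (rule orbit_altdef_bounded) simp
    also have "\<dots> = (\<lambda>m. (v ^^ m) x) ` {..<2}" by auto
    finally have "card (orbit v x) \<le> card {..<2::nat}" by (simp only: card_image_le finite_lessThan)
    then show False using assms(3) by simp
  qed
  show ne3: "v (v x) \<noteq> v x" using ne inj by blast
  have "finite (orbit v x)" using assms(3) by (metis card.infinite zero_neq_numeral)
  then have "{x, v x, v (v x)} = orbit v x"
    by (rule card_subset_eq) (use mem ne ne2 ne3 assms(3) in auto)
  then show eq: "orbit v x = {x, v x, v (v x)}" by simp
  show "v (v (v x)) = x" using mem(4) ne2 ne3 inj[of "v (v x)" x] inj[of "v (v x)" "v x"]
    unfolding eq by blast
qed

lemma cycles_on_transpose: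
  assumes "x \<noteq> y"
  shows "cycles_on (Transposition.transpose x y) {x, y} = {{x, y}}"
proof -
  have p: "Transposition.transpose x y permutes {x, y}" by (intro permutes_swap_id) auto
  have "orbit (Transposition.transpose x y) u = {x, y}" if "u \<in> {x, y}" for u
  proof
    show "orbit (Transposition.transpose x y) u \<subseteq> {x, y}" by (rule permutes_orbit_subset[OF p that])
    have "u \<in> orbit (Transposition.transpose x y) u" "Transposition.transpose x y u \<in> orbit (Transposition.transpose x y) u"
      using self_in_orbit_permutes[OF p] by (auto intro: orbit.intros)
    then show "{x, y} \<subseteq> orbit (Transposition.transpose x y) u" using that by auto
  qed
  then show ?thesis by (auto simp: cycles_on_def)
qed

lemma cycles_on_cycle3:
  assumes "x \<noteq> y" "x \<noteq> z" "y \<noteq> z"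
  shows "cycles_on (cycle3 x y z) {x, y, z} = {{x, y, z}}"
proof -
  let ?p = "cycle3 x y z"
  have "orbit ?p u = {x, y, z}" if "u \<in> {x, y, z}" for u
  proof
    show "orbit ?p u \<subseteq> {x, y, z}" by (rule permutes_orbit_subset[OF cycle3_permutes that])
    have "u \<in> orbit ?p u" "?p u \<in> orbit ?p u" "?p (?p u) \<in> orbit ?p u"
      using self_in_orbit_permutes[OF cycle3_permutes[of x y z]] by (auto intro: orbit.intros)
    then show "{x, y, z} \<subseteq> orbit ?p u" using that assms by (auto simp: cycle3_apply)
  qed
  then show ?thesis by (auto simp: cycles_on_def)
qed

lemma comp_transpose_in_perms_type_iff:
  assumes "q permutes C" "finite C" "x \<noteq> y" "x \<notin> C" "y \<notin> C"
  shows "Transposition.transpose x y \<circ> q \<in> perms_type ({x, y} \<union> C) k t \<longleftrightarrow>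
         k > 0 \<and> q \<in> perms_type C (k - 1) t"
proof -
  have p: "Transposition.transpose x y permutes {x, y}" by (intro permutes_swap_id) auto
  have d: "{x, y} \<inter> C = {}" using assms by auto
  have c: "card {x, y} = 2" using assms by auto
  have "Transposition.transpose x y \<in> perms23 {x, y}" using p assms c by (simp add: perms23_def cycles_on_transpose)
  moreover have "{w. w = {x, y} \<and> card w = 2} = {{x, y}}" "{w. w = {x, y} \<and> card w = 3} = {}"
    using c by auto
  then have "num_cycles (Transposition.transpose x y) {x, y} 2 = 1" "num_cycles (Transposition.transpose x y) {x, y} 3 = 0"
    using assms(3) by (simp_all add: num_cycles_def cycles_on_transpose)
  ultimately show ?thesis
    unfolding perms_type_def mem_Collect_eq perms23_comp_iff[OF p assms(1) d]
    using num_cycles_comp[OF p assms(1) d _ assms(2)] by (cases k) auto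
qed

lemma comp_cycle3_in_perms_type_iff:
  assumes "q permutes C" "finite C" "x \<noteq> y" "x \<noteq> z" "y \<noteq> z" "x \<notin> C" "y \<notin> C" "z \<notin> C"
  shows "cycle3 x y z \<circ> q \<in> perms_type ({x, y, z} \<union> C) k t \<longleftrightarrow>
         t > 0 \<and> q \<in> perms_type C k (t - 1)"
proof -
  have p: "cycle3 x y z permutes {x, y, z}" by (rule cycle3_permutes)
  have d: "{x, y, z} \<inter> C = {}" using assms by auto
  have c: "card {x, y, z} = 3" using assms by auto
  have "cycle3 x y z \<in> perms23 {x, y, z}" using p assms c by (simp add: perms23_def cycles_on_cycle3)
  moreover have "{w. w = {x, y, z} \<and> card w = 3} = {{x, y, z}}" "{w. w = {x, y, z} \<and> card w = 2} = {}"
    using c by auto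
  then have "num_cycles (cycle3 x y z) {x, y, z} 2 = 0" "num_cycles (cycle3 x y z) {x, y, z} 3 = 1"
    using assms(3-5) by (simp_all add: num_cycles_def cycles_on_cycle3)
  ultimately show ?thesis
    unfolding perms_type_def mem_Collect_eq perms23_comp_iff[OF p assms(1) d]
    using num_cycles_comp[OF p assms(1) d _ assms(2)] by (cases t) auto
qed

text \<open>The cycle through x is (x y) or (x y z), and removing it leaves a permutation of the
  remaining points. Ordered pairs (y, z) are right because a 3-set carries two 3-cycles. The guards
  on k and t are essential: with truncated subtraction, \<open>k - 1\<close> at k = 0 would admit
  permutations with one 2-cycle too many.\<close>

lemma perms_type_decompose:
  assumes A: "finite A" and x: "x \<in> A"
  shows "perms_type A k t =
     (\<lambda>(y, q). Transposition.transpose x y \<circ> q) `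
        (SIGMA y : A - {x}. if k > 0 then perms_type (A - {x, y}) (k - 1) t else {}) \<union>
     (\<lambda>((y, z), q). cycle3 x y z \<circ> q) `
        (SIGMA (y, z) : (SIGMA y : A - {x}. A - {x, y}).
           if t > 0 then perms_type (A - {x, y, z}) k (t - 1) else {})"
    (is "_ = ?F ` ?S \<union> ?G ` ?T")
proof (intro equalityI subsetI)
  fix v assume v: "v \<in> perms_type A k t"
  then have p: "v permutes A" by (simp add: perms_type_def perms23_def)
  have "orbit v x \<in> cycles_on v A" using x by (auto simp: cycles_on_def)
  then consider "card (orbit v x) = 2" | "card (orbit v x) = 3"
    using v by (auto simp: perms_type_def perms23_def)
  then show "v \<in> ?F ` ?S \<union> ?G ` ?T"
  proof cases
    case 1
    note o = orbit_card_2[OF p A 1]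
    let ?q = "perm_restrict v (A - {x, v x})"
    have sub: "{x, v x} \<subseteq> A" using p x by (simp add: permutes_in_image)
    note r = perm_restrict_invariant[OF p A sub]
    have inv: "v ` {x, v x} \<subseteq> {x, v x}" using o by simp
    have "perm_restrict v {x, v x} = Transposition.transpose x (v x)"
      using o by (auto simp: fun_eq_iff perm_restrict_def Transposition.transpose_def)
    then have eq: "v = Transposition.transpose x (v x) \<circ> ?q" using r(3)[OF inv] by simp
    have "{x, v x} \<union> (A - {x, v x}) = A" using sub by auto
    then have "k > 0 \<and> ?q \<in> perms_type (A - {x, v x}) (k - 1) t"
      using comp_transpose_in_perms_type_iff[OF r(2)[OF inv], of x "v x" k t] v eq o A by simp
    then have "(v x, ?q) \<in> ?S" using o(1) sub by simp
    then have "?F (v x, ?q) \<in> ?F ` ?S" by (rule imageI)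
    then show ?thesis using eq by simp
  next
    case 2
    note o = orbit_card_3[OF p A 2]
    let ?B = "{x, v x, v (v x)}"
    let ?q = "perm_restrict v (A - ?B)"
    have sub: "?B \<subseteq> A" using p x by (simp add: permutes_in_image)
    note r = perm_restrict_invariant[OF p A sub]
    have inv: "v ` ?B \<subseteq> ?B" using o by simp
    have "perm_restrict v ?B = cycle3 x (v x) (v (v x))"
      using o by (auto simp: fun_eq_iff perm_restrict_def cycle3_def Transposition.transpose_def)
    then have eq: "v = cycle3 x (v x) (v (v x)) \<circ> ?q" using r(3)[OF inv] by simp
    have "?B \<union> (A - ?B) = A" using sub by auto
    then have "t > 0 \<and> ?q \<in> perms_type (A - ?B) k (t - 1)"
      using comp_cycle3_in_perms_type_iff[OF r(2)[OF inv], of x "v x" "v (v x)" k t] v eq o A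
      by (simp add: eq_commute[of x] eq_commute[of "v x" "v (v x)"])
    then have "((v x, v (v x)), ?q) \<in> ?T" using o sub by simp
    then have "?G ((v x, v (v x)), ?q) \<in> ?G ` ?T" by (rule imageI)
    then show ?thesis using eq by simp
  qed
next
  fix v assume "v \<in> ?F ` ?S \<union> ?G ` ?T"
  then show "v \<in> perms_type A k t"
  proof
    assume "v \<in> ?F ` ?S"
    then obtain y q where y: "y \<in> A" "y \<noteq> x" and k: "k > 0" and q: "q \<in> perms_type (A - {x, y}) (k - 1) t"
      and v: "v = Transposition.transpose x y \<circ> q"
    proof -
      obtain u where u: "u \<in> ?S" "v = ?F u" using \<open>v \<in> ?F ` ?S\<close> by blast
      obtain y q where "u = (y, q)" by (cases u)
      then show thesis using u by (intro that[of y q]) (auto split: if_splits)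
    qed
    have eq: "{x, y} \<union> (A - {x, y}) = A" using y x by auto
    have "q permutes (A - {x, y})" using q by (simp add: perms_type_def perms23_def)
    then show ?thesis
      using comp_transpose_in_perms_type_iff[of q "A - {x, y}" x y k t] y k q A
      unfolding eq v by auto
  next
    assume "v \<in> ?G ` ?T"
    then obtain y z q where y: "y \<in> A" "y \<noteq> x" "z \<in> A" "z \<noteq> x" "z \<noteq> y" and k: "t > 0"
      and q: "q \<in> perms_type (A - {x, y, z}) k (t - 1)"
      and v: "v = cycle3 x y z \<circ> q"
    proof -
      obtain u where u: "u \<in> ?T" "v = ?G u" using \<open>v \<in> ?G ` ?T\<close> by blast
      obtain y z q where "u = ((y, z), q)" by (metis surj_pair)
      then show thesis using u by (intro that[of y z q]) (auto split: if_splits)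
    qed
    have eq: "{x, y, z} \<union> (A - {x, y, z}) = A" using y x by auto
    have "q permutes (A - {x, y, z})" using q by (simp add: perms_type_def perms23_def)
    then show ?thesis
      using comp_cycle3_in_perms_type_iff[of q "A - {x, y, z}" x y z k t] y k q A
      unfolding eq v by auto
  qed
qed

text \<open>The decomposition is also injective: y is \<open>v x\<close>, z is
  \<open>v (v x)\<close>, and q is recovered by cancelling an injective left factor. The two images
  are disjoint because \<open>v (v x) = x\<close> holds for the first kind only.\<close>

lemma card_perms_type_rec:
  assumes A: "finite A" and x: "x \<in> A"
  shows "card (perms_type A k t) =
     (\<Sum>y \<in> A - {x}. if k > 0 then card (perms_type (A - {x, y}) (k - 1) t) else 0) +
     (\<Sum>y \<in> A - {x}. \<Sum>z \<in> A - {x, y}. if t > 0 then card (perms_type (A - {x, y, z}) k (t - 1)) else 0)"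
proof -
  define S where "S = (SIGMA y : A - {x}. if k > 0 then perms_type (A - {x, y}) (k - 1) t else {})"
  define T where "T = (SIGMA (y, z) : (SIGMA y : A - {x}. A - {x, y}).
           if t > 0 then perms_type (A - {x, y, z}) k (t - 1) else {})"
  define F where "F = (\<lambda>(y, q :: 'a \<Rightarrow> 'a). Transposition.transpose x y \<circ> q)"
  define G where "G = (\<lambda>((y, z), q :: 'a \<Rightarrow> 'a). cycle3 x y z \<circ> q)"
  have finS: "finite S" using A by (auto simp: S_def finite_perms_type)
  have finT: "finite T" unfolding T_def
    using A by (cases "t > 0") (auto simp: finite_perms_type intro!: finite_SigmaI)
  have Fx: "F (y, q) x = y" if "(y, q) \<in> S" for y q
    using that by (auto simp: S_def F_def perms_type_def perms23_def permutes_not_in split: if_splits)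
  have Fxx: "F (y, q) y = x" if "(y, q) \<in> S" for y q
    using that by (auto simp: S_def F_def perms_type_def perms23_def permutes_not_in split: if_splits)
  have Gx: "G ((y, z), q) x = y" "G ((y, z), q) y = z" "z \<noteq> x" if "((y, z), q) \<in> T" for y z q
  proof -
    have ne: "x \<noteq> y" "x \<noteq> z" "y \<noteq> z" and q: "q \<in> perms_type (A - {x, y, z}) k (t - 1)"
      using that by (auto simp: T_def split: if_splits)
    from q have "q permutes (A - {x, y, z})" by (simp add: perms_type_def perms23_def)
    then have "q x = x" "q y = y" by (auto intro: permutes_not_in)
    then show "G ((y, z), q) x = y" "G ((y, z), q) y = z" "z \<noteq> x"
      using ne by (simp_all add: G_def cycle3_apply)
  qed
  have "inj_on F S"
  proof (rule inj_onI)
    fix u u' assume u: "u \<in> S" "u' \<in> S" "F u = F u'"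
    obtain y q y' q' where uu: "u = (y, q)" "u' = (y', q')" by (metis surj_pair)
    note * = u[unfolded uu]
    have "y = y'" using Fx[OF *(1)] Fx[OF *(2)] *(3) by simp
    then show "u = u'" using *(3) uu by (auto simp: F_def fun_eq_iff dest: injD[OF inj_transpose])
  qed
  moreover have "inj_on G T"
  proof (rule inj_onI)
    fix u u' assume u: "u \<in> T" "u' \<in> T" "G u = G u'"
    obtain y z q y' z' q' where uu: "u = ((y, z), q)" "u' = ((y', z'), q')" by (metis surj_pair)
    note * = u[unfolded uu]
    have y: "y = y'" using Gx(1)[OF *(1)] Gx(1)[OF *(2)] *(3) by simp
    have z: "z = z'" using Gx(2)[OF *(1)] Gx(2)[OF *(2)] *(3) y by simp
    have "inj (cycle3 x y z)" by (rule permutes_inj[OF cycle3_permutes])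
    then show "u = u'" using *(3) y z uu by (auto simp: G_def fun_eq_iff dest: injD)
  qed
  moreover have "F ` S \<inter> G ` T = {}"
  proof -
    have False if *: "(y, q) \<in> S" "((y', z'), q') \<in> T" "F (y, q) = G ((y', z'), q')" for y q y' z' q'
      using Fx[OF *(1)] Fxx[OF *(1)] Gx[OF *(2)] *(3) by metis
    then show ?thesis by (fastforce simp: disjoint_iff)
  qed
  moreover have "perms_type A k t = F ` S \<union> G ` T"
    unfolding F_def G_def S_def T_def by (rule perms_type_decompose[OF A x])
  ultimately have "card (perms_type A k t) = card S + card T"
    using finS finT by (simp add: card_Un_disjoint card_image)
  also have "card S = (\<Sum>y \<in> A - {x}. if k > 0 then card (perms_type (A - {x, y}) (k - 1) t) else 0)"
    unfolding S_def using A by (cases "k > 0") (auto simp: finite_perms_type card_SigmaI)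
  also have "card T = (\<Sum>(y, z) \<in> (SIGMA y : A - {x}. A - {x, y}).
      if t > 0 then card (perms_type (A - {x, y, z}) k (t - 1)) else 0)"
    unfolding T_def using A
    by (cases "t > 0", simp_all, subst card_SigmaI) (auto simp: finite_perms_type intro!: sum.cong)
  also have "\<dots> = (\<Sum>y \<in> A - {x}. \<Sum>z \<in> A - {x, y}. if t > 0 then card (perms_type (A - {x, y, z}) k (t - 1)) else 0)"
    using A by (subst sum.Sigma) auto
  finally show ?thesis .
qed

text \<open>Reciprocal of the order of the centralizer of a permutation with k 2-cycles and t
  3-cycles, that is, the share of this conjugacy class in the symmetric group on 2k + 3t
  points.\<close>

definition cycle_weight :: "nat \<Rightarrow> nat \<Rightarrow> real" where
  "cycle_weight k t = 1 / (2 ^ k * fact k * 3 ^ t * fact t)"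

lemma cycle_weight_pos: "cycle_weight k t > 0"
  by (simp add: cycle_weight_def)

lemma cycle_weight_Suc:
  "cycle_weight k t = 2 * real (Suc k) * cycle_weight (Suc k) t"
  "cycle_weight k t = 3 * real (Suc t) * cycle_weight k (Suc t)"
  by (simp_all add: cycle_weight_def divide_simps del: of_nat_Suc)

text \<open>Induction on the size N of A, removing the cycle of one point x. The permutations with x
  in a 2-cycle account for 2k/N of the claimed count and those with x in a 3-cycle for 3t/N; the
  shares add up to 1 because N = 2k + 3t.\<close>

lemma card_perms_type:
  assumes "finite A"
  shows "real (card (perms_type A k t)) =
    (if card A = 2 * k + 3 * t then fact (card A) * cycle_weight k t else 0)"
  using assms
proof (induction "card A" arbitrary: A k t rule: less_induct)
  case less
  show ?case
  proof (cases "A = {}")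
    case True
    have "perms_type {} k t = (if k = 0 \<and> t = 0 then {id :: 'a \<Rightarrow> 'a} else {})"
      by (auto simp: perms_type_def perms23_def cycles_on_def num_cycles_def)
    then show ?thesis using True by (simp add: cycle_weight_def)
  next
    case False
    then obtain x where x: "x \<in> A" by auto
    define N where "N = card A"
    have N: "N > 0" using False less.prems by (simp add: N_def card_gt_0_iff)
    have 1: "real (card (perms_type (A - {x, y}) (k - 1) t)) =
       (if N = 2 * k + 3 * t then fact (N - 2) * cycle_weight (k - 1) t else 0)"
      if "y \<in> A - {x}" "k > 0" for y
    proof -
      have c: "card {x, y} = 2" "{x, y} \<subseteq> A" using that x by auto
      then have "card (A - {x, y}) = N - 2" "N \<ge> 2"
        using less.prems card_mono[of A "{x, y}"] by (auto simp: N_def card_Diff_subset)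
      moreover have "N - 2 = 2 * (k - 1) + 3 * t \<longleftrightarrow> N = 2 * k + 3 * t"
        using that \<open>N \<ge> 2\<close> by auto
      ultimately show ?thesis using less.hyps[of "A - {x, y}" "k - 1" t] less.prems
        by (simp add: N_def)
    qed
    have 2: "real (card (perms_type (A - {x, y, z}) k (t - 1))) =
       (if N = 2 * k + 3 * t then fact (N - 3) * cycle_weight k (t - 1) else 0)"
      if "y \<in> A - {x}" "z \<in> A - {x, y}" "t > 0" for y z
    proof -
      have c: "card {x, y, z} = 3" "{x, y, z} \<subseteq> A" using that x by auto
      then have "card (A - {x, y, z}) = N - 3" "N \<ge> 3"
        using less.prems card_mono[of A "{x, y, z}"] by (auto simp: N_def card_Diff_subset)
      moreover have "N - 3 = 2 * k + 3 * (t - 1) \<longleftrightarrow> N = 2 * k + 3 * t"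
        using that \<open>N \<ge> 3\<close> by auto
      ultimately show ?thesis using less.hyps[of "A - {x, y, z}" k "t - 1"] less.prems
        by (simp add: N_def)
    qed
    have cA: "card (A - {x}) = N - 1" using x less.prems by (simp add: N_def)
    have cA2: "card (A - {x, y}) = N - 2" if "y \<in> A - {x}" for y
    proof -
      have "card {x, y} = 2" "{x, y} \<subseteq> A" using that x by auto
      then show ?thesis using less.prems by (simp add: N_def card_Diff_subset)
    qed
    have "real (card (perms_type A k t)) =
      (\<Sum>y \<in> A - {x}. if k > 0 then real (card (perms_type (A - {x, y}) (k - 1) t)) else 0) +
      (\<Sum>y \<in> A - {x}. \<Sum>z \<in> A - {x, y}. if t > 0 then real (card (perms_type (A - {x, y, z}) k (t - 1))) else 0)"
      unfolding card_perms_type_rec[OF less.prems x] of_nat_add of_nat_sum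
      by (intro arg_cong2[where f = "(+)"] sum.cong refl) auto
    also have "\<dots> = (\<Sum>y \<in> A - {x}. if k > 0 \<and> N = 2 * k + 3 * t then fact (N - 2) * cycle_weight (k - 1) t else 0) +
       (\<Sum>y \<in> A - {x}. \<Sum>z \<in> A - {x, y}. if t > 0 \<and> N = 2 * k + 3 * t then fact (N - 3) * cycle_weight k (t - 1) else 0)"
      using 1 2 by (intro arg_cong2[where f = "(+)"] sum.cong refl) auto
    also have "\<dots> = real (N - 1) * (if k > 0 \<and> N = 2 * k + 3 * t then fact (N - 2) * cycle_weight (k - 1) t else 0) +
       real (N - 1) * (real (N - 2) * (if t > 0 \<and> N = 2 * k + 3 * t then fact (N - 3) * cycle_weight k (t - 1) else 0))"
      by (simp add: cA cA2)
    also have "\<dots> = (if N = 2 * k + 3 * t then fact N * cycle_weight k t else 0)"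
    proof (cases "N = 2 * k + 3 * t")
      case True
      have a: "real (N - 1) * (if k > 0 then fact (N - 2) * cycle_weight (k - 1) t else 0) =
        fact (N - 1) * cycle_weight k t * real (2 * k)"
      proof (cases k)
        case (Suc k')
        then have "N - 1 = Suc (N - 2)" using True by simp
        then have "fact (N - 1) = real (N - 1) * fact (N - 2)" by (metis fact_Suc)
        then show ?thesis using Suc by (simp add: cycle_weight_Suc(1)[of k' t] algebra_simps)
      qed simp
      have b: "real (N - 1) * (real (N - 2) * (if t > 0 then fact (N - 3) * cycle_weight k (t - 1) else 0)) =
        fact (N - 1) * cycle_weight k t * real (3 * t)"
      proof (cases t)
        case (Suc t')
        then have "N - 1 = Suc (N - 2)" "N - 2 = Suc (N - 3)" using True by simp_all
        then have "fact (N - 1) = real (N - 1) * (real (N - 2) * fact (N - 3))" by (metis fact_Suc)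
        then show ?thesis using Suc by (simp add: cycle_weight_Suc(2)[of k t'] algebra_simps)
      qed simp
      have "fact N = real N * fact (N - 1)" using N by (simp add: fact_reduce)
      then show ?thesis using a b True by (simp add: algebra_simps)
    qed auto
    finally show ?thesis by (simp add: N_def)
  qed
qed

text \<open>A fixed-point-free involution has 2-cycles only, so the count made for v also counts the
  matchings.\<close>

lemma matchings_eq_perms_type: 
  assumes "finite A"
  shows "matchings A = (\<Union>k. perms_type A k 0)"
proof (intro equalityI subsetI)
  fix e assume e: "e \<in> matchings A"
  have 2: "card (orbit e x) = 2" if "x \<in> A" for x
  proof -
    have *: "(e ^^ 2) x = x" "e x \<noteq> x" using e that by (auto simp: matchings_def numeral_2_eq_2)
    have "orbit e x = {(e ^^ m) x |m. m < 2}" by (rule orbit_altdef_bounded[OF *(1)]) simp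
    also have "\<dots> = {x, e x}" by (auto simp: less_2_cases_iff intro: exI[of _ 0] exI[of _ "Suc 0"])
    finally show ?thesis using * by simp
  qed
  then have "e \<in> perms_type A (num_cycles e A 2) 0"
  proof -
    have "{c \<in> cycles_on e A. card c = 3} = {}" using 2 by (auto simp: cycles_on_def)
    then have "num_cycles e A 3 = 0" by (simp only: num_cycles_def card.empty)
    then show ?thesis
      using e 2 by (auto simp: perms_type_def perms23_def matchings_def cycles_on_def)
  qed
  then show "e \<in> (\<Union>k. perms_type A k 0)" by blast
next
  fix e assume "e \<in> (\<Union>k. perms_type A k 0)"
  then have p: "e permutes A" and c: "\<forall>c \<in> cycles_on e A. card c = 2 \<or> card c = 3"
    and "num_cycles e A 3 = 0" by (auto simp: perms_type_def perms23_def)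
  then have "card c = 2" if "c \<in> cycles_on e A" for c
    using that assms finite_cycles_on[of A e] by (auto simp: num_cycles_def)
  then have "card (orbit e x) = 2" if "x \<in> A" for x using that by (auto simp: cycles_on_def)
  then show "e \<in> matchings A" using orbit_card_2[OF p assms] p by (auto simp: matchings_def)
qed

lemma card_matchings:
  assumes "finite A"
  shows "real (card (matchings A)) =
    (if even (card A) then fact (card A) / (2 ^ (card A div 2) * fact (card A div 2)) else 0)"
proof -
  have empty: "perms_type A k 0 = {}" if "card A \<noteq> 2 * k" for k
    using card_perms_type[OF assms, of k 0] that finite_perms_type[OF assms] by simp
  show ?thesis
  proof (cases "even (card A)")
    case True
    then obtain b where b: "card A = 2 * b" by auto
    have "matchings A = perms_type A b 0"
      unfolding matchings_eq_perms_type[OF assms]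
    proof (intro equalityI UN_least)
      show "perms_type A k 0 \<subseteq> perms_type A b 0" for k
        using empty[of k] b by (cases "k = b") auto
    qed auto
    then show ?thesis using card_perms_type[OF assms, of b 0] b by (simp add: cycle_weight_def)
  next
    case False
    then have "perms_type A k 0 = {}" for k by (intro empty) auto
    then show ?thesis using False by (simp add: matchings_eq_perms_type[OF assms])
  qed
qed

text \<open>From 2n = 2k + 3t the number t is even, say t = 2s, and then k = n - 3s; so one index s
  up to \<open>n div 3\<close> lists all types. Vector-valued g lets the same formula yield both
  moments and the complex characteristic function.\<close>

lemma sum_perms23:
  fixes g :: "nat \<Rightarrow> 'b :: real_vector"
  assumes "finite A" "card A = 2 * n"
  shows "(\<Sum>v \<in> perms23 A. g (num_cycles v A 2)) =
    fact (2 * n) *\<^sub>R (\<Sum>s \<le> n div 3. cycle_weight (n - 3 * s) (2 * s) *\<^sub>R g (n - 3 * s))"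
proof -
  have eq: "perms23 A = (\<Union>s \<in> {..n div 3}. perms_type A (n - 3 * s) (2 * s))"
  proof (intro equalityI subsetI)
    fix v assume "v \<in> perms23 A"
    then have v: "v \<in> perms_type A (num_cycles v A 2) (num_cycles v A 3)" (is "_ \<in> perms_type A ?k ?t")
      by (simp add: perms_type_def)
    then have "perms_type A ?k ?t \<noteq> {}" by blast
    then have "card (perms_type A ?k ?t) \<noteq> 0" using finite_perms_type[OF assms(1)] by simp
    then have "2 * n = 2 * ?k + 3 * ?t"
      using card_perms_type[OF assms(1), of ?k ?t] assms(2) by (auto split: if_splits)
    moreover from this have "even ?t" by (metis dvd_add_right_iff dvd_triv_left even_mult_iff odd_numeral)
    then obtain s where s: "?t = 2 * s" by auto
    ultimately have "?k = n - 3 * s" "s \<in> {..n div 3}" by auto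
    then show "v \<in> (\<Union>s \<in> {..n div 3}. perms_type A (n - 3 * s) (2 * s))" using v s by auto
  qed (auto simp: perms_type_def)
  have disj: "perms_type A (n - 3 * s) (2 * s) \<inter> perms_type A (n - 3 * s') (2 * s') = {}" if "s \<noteq> s'" for s s'
    using that by (auto simp: perms_type_def)
  have "(\<Sum>v \<in> perms23 A. g (num_cycles v A 2)) =
     (\<Sum>s \<in> {..n div 3}. \<Sum>v \<in> perms_type A (n - 3 * s) (2 * s). g (num_cycles v A 2))"
    unfolding eq by (rule sum.UNION_disjoint) (simp_all add: finite_perms_type[OF assms(1)] disj)
  also have "\<dots> = (\<Sum>s \<in> {..n div 3}. real (card (perms_type A (n - 3 * s) (2 * s))) *\<^sub>R g (n - 3 * s))"
    by (intro sum.cong refl) (simp add: perms_type_def sum_constant_scaleR)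
  also have "\<dots> = (\<Sum>s \<in> {..n div 3}. (fact (2 * n) * cycle_weight (n - 3 * s) (2 * s)) *\<^sub>R g (n - 3 * s))"
    by (intro sum.cong refl, subst card_perms_type) (use assms in auto)
  finally show ?thesis by (simp add: scaleR_sum_right)
qed

subsection \<open>Disconnected pairs\<close>

text \<open>The coefficient of x^(2n) in exp(x^2/2 + x^3/3), the generating function of permutations
  with cycles of lengths 2 and 3 only.\<close>

definition type_sum :: "nat \<Rightarrow> real" where
  "type_sum n = (\<Sum>s \<le> n div 3. cycle_weight (n - 3 * s) (2 * s))"

lemma type_sum_pos: "type_sum n > 0"
  unfolding type_sum_def by (rule sum_pos) (auto simp: cycle_weight_pos)

(* Equals 2^b |perms23 A| |matchings A| / |A|! for |A| = 2b, by card_perms23_matchings. *)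
definition pair_weight :: "nat \<Rightarrow> real" where
  "pair_weight b = fact (2 * b) / fact b * type_sum b"

lemma pair_weight_pos: "pair_weight b > 0"
  by (simp add: pair_weight_def type_sum_pos)

lemma card_perms23:
  assumes "finite A" "card A = 2 * n"
  shows "real (card (perms23 A)) = fact (2 * n) * type_sum n"
  using sum_perms23[OF assms, of "\<lambda>_. 1 :: real"] by (simp add: type_sum_def)

lemma card_perms23_matchings:
  assumes "finite A" "card A = 2 * n"
  shows "real (card (perms23 A)) * real (card (matchings A)) = fact (2 * n) / 2 ^ n * pair_weight n"
  using assms by (simp add: card_perms23[OF assms] card_matchings pair_weight_def field_simps)

text \<open>A permutation is the composition of its restrictions to an invariant set and to the
  complement, so the pair of restrictions determines it. The family P stands for
  \<open>perms23\<close> and for \<open>matchings\<close>.\<close>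

lemma card_invariant_le:
  assumes A: "finite A" and S: "S \<subseteq> A"
    and P: "\<And>v. v \<in> P A \<Longrightarrow> v permutes A"
    and R: "\<And>v. v \<in> P A \<Longrightarrow> v ` S \<subseteq> S \<Longrightarrow> perm_restrict v S \<in> P S \<and> perm_restrict v (A - S) \<in> P (A - S)"
    and fin: "finite (P S)" "finite (P (A - S))"
  shows "card {v \<in> P A. v ` S \<subseteq> S} \<le> card (P S) * card (P (A - S))"
proof -
  have "card {v \<in> P A. v ` S \<subseteq> S} \<le> card (P S \<times> P (A - S))"
  proof (rule card_inj_on_le[where f = "\<lambda>v. (perm_restrict v S, perm_restrict v (A - S))"])
    show "inj_on (\<lambda>v. (perm_restrict v S, perm_restrict v (A - S))) {v \<in> P A. v ` S \<subseteq> S}"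
    proof (rule inj_onI)
      fix v w assume "v \<in> {v \<in> P A. v ` S \<subseteq> S}" and "w \<in> {v \<in> P A. v ` S \<subseteq> S}"
        and eq: "(perm_restrict v S, perm_restrict v (A - S)) = (perm_restrict w S, perm_restrict w (A - S))"
      then have v: "v \<in> P A" "v ` S \<subseteq> S" and w: "w \<in> P A" "w ` S \<subseteq> S" by simp_all
      have "perm_restrict v S \<circ> perm_restrict v (A - S) = v"
        by (rule perm_restrict_invariant(3)[OF P[OF v(1)] A S v(2)])
      moreover have "perm_restrict w S \<circ> perm_restrict w (A - S) = w"
        by (rule perm_restrict_invariant(3)[OF P[OF w(1)] A S w(2)])
      ultimately show "v = w" using eq by (metis Pair_inject)
    qed
    show "(\<lambda>v. (perm_restrict v S, perm_restrict v (A - S))) ` {v \<in> P A. v ` S \<subseteq> S} \<subseteq> P S \<times> P (A - S)"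
      using R by (intro image_subsetI) simp
  qed (use fin in simp)
  then show ?thesis by (simp add: card_cartesian_product)
qed

lemma card_perms23_invariant_le:
  assumes A: "finite A" and S: "S \<subseteq> A"
  shows "card {v \<in> perms23 A. v ` S \<subseteq> S} \<le> card (perms23 S) * card (perms23 (A - S))"
proof (rule card_invariant_le[OF A S])
  fix v assume v: "v \<in> perms23 A" "v ` S \<subseteq> S"
  then have p: "v permutes A" by (simp add: perms23_def)
  have "S \<union> (A - S) = A" using S by auto
  then show "perm_restrict v S \<in> perms23 S \<and> perm_restrict v (A - S) \<in> perms23 (A - S)"
    using perms23_comp_iff[OF perm_restrict_invariant(1,2)[OF p A S v(2)]]
      perm_restrict_invariant(3)[OF p A S v(2)] v(1) by auto
qed (use A S finite_subset in \<open>auto simp: perms23_def intro!: finite_perms23[unfolded perms23_def]\<close>)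

lemma card_matchings_invariant_le:
  assumes A: "finite A" and S: "S \<subseteq> A"
  shows "card {v \<in> matchings A. v ` S \<subseteq> S} \<le> card (matchings S) * card (matchings (A - S))"
proof (rule card_invariant_le[OF A S])
  fix v assume v: "v \<in> matchings A" "v ` S \<subseteq> S"
  then have p: "v permutes A" by (simp add: matchings_def)
  note r = perm_restrict_invariant(1,2)[OF p A S v(2)]
  have "v x \<in> A - S" if "x \<in> A - S" for x
    using permutes_in_image[OF r(2), of x] that by (simp add: perm_restrict_simps)
  then show "perm_restrict v S \<in> matchings S \<and> perm_restrict v (A - S) \<in> matchings (A - S)"
    using r v S by (auto simp: matchings_def perm_restrict_def)
qed (use A S finite_subset in \<open>auto simp: matchings_def intro!: finite_matchings[unfolded matchings_def]\<close>)

lemma connected_23_maps_subset: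
  "connected_23_maps n \<subseteq> perms23 {1..2 * n} \<times> matchings {1..2 * n}"
  unfolding connected_23_maps_def perms23_def matchings_def sym_group_carrier by auto

text \<open>If no group element takes x to y, the orbit of x under the generated group is such a
  set: it contains x, misses y, and is closed under both generators.\<close>

lemma disconnected_invariant_set:
  assumes "(v, e) \<in> perms23 {1..2 * n} \<times> matchings {1..2 * n}" "(v, e) \<notin> connected_23_maps n"
  shows "\<exists>S. S \<subseteq> {1..2 * n} \<and> S \<noteq> {} \<and> S \<noteq> {1..2 * n} \<and> v ` S \<subseteq> S \<and> e ` S \<subseteq> S"
proof -
  let ?G = "sym_group (2 * n)"
  have car: "{v, e} \<subseteq> carrier ?G"
    using assms(1) by (auto simp: perms23_def matchings_def sym_group_carrier)
  then obtain x y where xy: "x \<in> {1..2 * n}" "y \<in> {1..2 * n}"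
    and no: "\<And>g. g \<in> generate ?G {v, e} \<Longrightarrow> g x \<noteq> y"
    using assms by (fastforce simp: connected_23_maps_def perms23_def matchings_def)
  define S where "S = (\<lambda>g. g x) ` generate ?G {v, e}"
  have "S \<subseteq> {1..2 * n}"
  proof
    fix z assume "z \<in> S"
    then obtain g where g: "g \<in> generate ?G {v, e}" "z = g x" by (auto simp: S_def)
    have "g permutes {1..2 * n}"
      using group.generate_in_carrier[OF sym_group_is_group car g(1)] by (simp add: sym_group_carrier)
    then show "z \<in> {1..2 * n}" using g xy(1) permutes_in_image by metis
  qed
  moreover have "x \<in> S"
    unfolding S_def using generate.one[of ?G "{v, e}"] by (intro image_eqI[of _ _ id]) (simp_all add: sym_group_one)
  moreover have "y \<notin> S" using no by (auto simp: S_def)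
  moreover have "h ` S \<subseteq> S" if "h \<in> {v, e}" for h
  proof
    fix z assume "z \<in> h ` S"
    then obtain g where g: "g \<in> generate ?G {v, e}" "z = h (g x)" by (auto simp: S_def)
    have "h \<otimes>\<^bsub>?G\<^esub> g \<in> generate ?G {v, e}"
      by (rule generate.eng[OF generate.incl[OF that] g(1)])
    then have "(h \<circ> g) x \<in> S" unfolding S_def sym_group_mult by (rule imageI)
    then show "z \<in> S" using g by simp
  qed
  ultimately show ?thesis using xy by blast
qed

text \<open>Union bound over the invariant sets, grouped by size. Odd sizes drop out because such a
  set has no matching. For size 2b there are (2n choose 2b) sets, and the normalisation of
  \<open>pair_weight\<close> is made so that this binomial coefficient and the powers of 2 cancel,
  leaving a pure convolution quotient.\<close>

lemma card_disconnected_le: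
  fixes n :: nat
  defines "Q \<equiv> perms23 {1..2 * n} \<times> matchings {1..2 * n}"
  shows "real (card (Q - connected_23_maps n)) \<le>
    (\<Sum>b = 1..<n. pair_weight b * pair_weight (n - b) / pair_weight n) * real (card Q)"
proof -
  define A where "A = {1..2 * n}"
  have A: "finite A" "card A = 2 * n" by (simp_all add: A_def)
  have finQ: "finite Q" using A by (simp add: Q_def A_def finite_perms23 finite_matchings)
  define Inv where "Inv = (\<lambda>S. {v \<in> perms23 A. v ` S \<subseteq> S} \<times> {e \<in> matchings A. e ` S \<subseteq> S})"
  define \<SS> where "\<SS> = {S. S \<subseteq> A \<and> S \<noteq> {} \<and> S \<noteq> A}"
  have fin\<SS>: "finite \<SS>" using A by (simp add: \<SS>_def)
  define T where "T = (\<lambda>b. {S. S \<subseteq> A \<and> card S = 2 * b})"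
  have finT: "finite (T b)" for b using A by (simp add: T_def)
  have cardInv: "real (card (Inv S)) \<le>
     real (card (perms23 S)) * real (card (matchings S)) *
     (real (card (perms23 (A - S))) * real (card (matchings (A - S))))" if "S \<subseteq> A" for S
  proof -
    have "card (Inv S) \<le> (card (perms23 S) * card (perms23 (A - S))) * (card (matchings S) * card (matchings (A - S)))"
      unfolding Inv_def card_cartesian_product
      by (intro mult_le_mono card_perms23_invariant_le card_matchings_invariant_le A that)
    then have "real (card (Inv S)) \<le> real ((card (perms23 S) * card (perms23 (A - S))) * (card (matchings S) * card (matchings (A - S))))"
      by (rule of_nat_mono)
    then show ?thesis by (simp add: mult_ac)
  qed
  have inv_odd: "card (Inv S) = 0" if "S \<subseteq> A" "odd (card S)" for S
  proof -
    have "finite S" using that A finite_subset by blast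
    then have "card (matchings S) = 0" using card_matchings[of S] that by simp
    then show ?thesis using cardInv[OF that(1)] by simp
  qed
  have inv_even: "real (card (Inv S)) \<le> fact (2 * b) * fact (2 * (n - b)) / 2 ^ n * (pair_weight b * pair_weight (n - b))"
    if "S \<in> T b" "b \<le> n" for S b
  proof -
    have S: "S \<subseteq> A" "card S = 2 * b" "finite S" "finite (A - S)"
      using that A finite_subset by (auto simp: T_def)
    then have c: "card (A - S) = 2 * (n - b)" using A by (simp add: card_Diff_subset algebra_simps)
    have "(2 :: real) ^ n = 2 ^ b * 2 ^ (n - b)" using that by (simp flip: power_add)
    then show ?thesis
      using cardInv[OF S(1)] unfolding card_perms23_matchings[OF S(3,2)] card_perms23_matchings[OF S(4) c]
      by (simp add: mult_ac)
  qed
  have "Q - connected_23_maps n \<subseteq> (\<Union>S \<in> \<SS>. Inv S)"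
    using disconnected_invariant_set[of _ _ n] unfolding Q_def Inv_def \<SS>_def A_def by fastforce
  then have "card (Q - connected_23_maps n) \<le> card (\<Union>S \<in> \<SS>. Inv S)"
    using A by (intro card_mono finite_UN_I fin\<SS>) (simp_all add: Inv_def finite_perms23 finite_matchings)
  also have "\<dots> \<le> (\<Sum>S \<in> \<SS>. card (Inv S))" by (rule card_UN_le[OF fin\<SS>])
  also have "\<dots> = (\<Sum>S \<in> (\<Union>b \<in> {1..<n}. T b). card (Inv S))"
  proof (rule sum.mono_neutral_right[OF fin\<SS>])
    show "(\<Union>b \<in> {1..<n}. T b) \<subseteq> \<SS>" using A by (auto simp: T_def \<SS>_def)
    show "\<forall>S \<in> \<SS> - (\<Union>b \<in> {1..<n}. T b). card (Inv S) = 0"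
    proof
      fix S assume S: "S \<in> \<SS> - (\<Union>b \<in> {1..<n}. T b)"
      then have "S \<subset> A" "S \<noteq> {}" by (auto simp: \<SS>_def)
      then have "card S < 2 * n" "card S > 0" using A psubset_card_mono[of A S] finite_subset[of S A] by (auto simp: card_gt_0_iff)
      then have "odd (card S)" using S \<open>S \<subset> A\<close> by (auto simp: T_def elim!: evenE)
      then show "card (Inv S) = 0" using \<open>S \<subset> A\<close> by (intro inv_odd) auto
    qed
  qed
  also have "\<dots> = (\<Sum>b \<in> {1..<n}. \<Sum>S \<in> T b. card (Inv S))"
    by (rule sum.UNION_disjoint) (auto simp: finT, auto simp: T_def)
  finally have "real (card (Q - connected_23_maps n)) \<le> (\<Sum>b \<in> {1..<n}. \<Sum>S \<in> T b. real (card (Inv S)))"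
    by (simp only: of_nat_sum[symmetric] of_nat_le_iff)
  also have "\<dots> \<le> (\<Sum>b \<in> {1..<n}. \<Sum>S \<in> T b. fact (2 * b) * fact (2 * (n - b)) / 2 ^ n * (pair_weight b * pair_weight (n - b)))"
    by (intro sum_mono inv_even) auto
  also have "\<dots> = (\<Sum>b \<in> {1..<n}. pair_weight b * pair_weight (n - b) / pair_weight n * real (card Q))"
  proof (rule sum.cong[OF refl])
    fix b assume b: "b \<in> {1..<n}"
    have "card (T b) = (2 * n) choose (2 * b)" unfolding T_def using n_subsets[OF A(1), of "2 * b"] A(2) by simp
    then have "real (card (T b)) = fact (2 * n) / (fact (2 * b) * fact (2 * (n - b)))"
      using b by (simp add: binomial_fact algebra_simps)
    moreover have "real (card Q) = fact (2 * n) / 2 ^ n * pair_weight n"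
      using card_perms23_matchings[OF A] by (simp add: Q_def A_def card_cartesian_product)
    ultimately show "(\<Sum>S \<in> T b. fact (2 * b) * fact (2 * (n - b)) / 2 ^ n * (pair_weight b * pair_weight (n - b))) =
      pair_weight b * pair_weight (n - b) / pair_weight n * real (card Q)"
      using pair_weight_pos[of n] by simp
  qed
  finally show ?thesis by (simp add: sum_distrib_right)
qed

subsection \<open>The law of the number of 2-cycles\<close>

text \<open>Expectation over the number of 2-cycles of a uniform element of \<open>perms23\<close>,
  as a finite weighted sum, so that linearity and differentiation under it need no integrability
  argument.\<close>

definition type_exp :: "nat \<Rightarrow> (real \<Rightarrow> 'b) \<Rightarrow> 'b::real_vector" where
  "type_exp n g = (\<Sum>s \<le> n div 3. (cycle_weight (n - 3 * s) (2 * s) / type_sum n) *\<^sub>R g (real (n - 3 * s)))"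

lemma type_exp_const [simp]: "type_exp n (\<lambda>_. c) = c"
proof -
  have "(\<Sum>s \<le> n div 3. cycle_weight (n - 3 * s) (2 * s) / type_sum n) = 1"
    using type_sum_pos[of n] by (simp add: type_sum_def flip: sum_divide_distrib)
  then show ?thesis by (simp add: type_exp_def flip: scaleR_sum_left)
qed

lemma type_exp_add: "type_exp n (\<lambda>k. f k + g k) = type_exp n f + type_exp n g"
  by (simp add: type_exp_def scaleR_add_right sum.distrib)

lemma type_exp_diff: "type_exp n (\<lambda>k. f k - g k) = type_exp n f - type_exp n g"
  by (simp add: type_exp_def scaleR_diff_right sum_subtractf)

lemma type_exp_scaleR: "type_exp n (\<lambda>k. c *\<^sub>R f k) = c *\<^sub>R type_exp n f"
  by (simp add: type_exp_def scaleR_sum_right mult.commute)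

lemma type_exp_cmult:
  fixes f :: "real \<Rightarrow> 'b :: real_algebra"
  shows "type_exp n (\<lambda>k. c * f k) = c * type_exp n f"
  by (simp add: type_exp_def sum_distrib_left)

text \<open>The comparison is asked for at natural numbers only: the fourth-moment estimate relies
  on k(k-1)(k-2) >= 0, which fails between 1 and 2.\<close>

lemma type_exp_mono:
  fixes f :: "real \<Rightarrow> real"
  assumes "\<And>j :: nat. f (real j) \<le> g (real j)"
  shows "type_exp n f \<le> type_exp n g"
  unfolding type_exp_def
  by (intro sum_mono scaleR_left_mono assms)
    (intro less_imp_le divide_pos_pos cycle_weight_pos type_sum_pos)

lemma norm_type_exp_le:
  fixes f :: "real \<Rightarrow> 'b :: real_normed_vector"
  shows "norm (type_exp n f) \<le> type_exp n (\<lambda>k. norm (f k))"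
  unfolding type_exp_def
  using cycle_weight_pos type_sum_pos[of n]
  by (intro order_trans[OF norm_sum]) (simp add: less_imp_le)

lemma norm_type_exp_bound:
  fixes f :: "real \<Rightarrow> 'b :: real_normed_vector"
  assumes "\<And>k. norm (f k) \<le> c * g k"
  shows "norm (type_exp n f) \<le> c * type_exp n g"
proof -
  have "type_exp n (\<lambda>k. norm (f k)) \<le> type_exp n (\<lambda>k. c * g k)"
    by (rule type_exp_mono) (rule assms)
  then show ?thesis using norm_type_exp_le[of n f] by (simp add: type_exp_cmult)
qed

text \<open>Detailed balance for the move s to s + 1, which replaces three 2-cycles by two 3-cycles:
  the weight at s times the first coefficient equals the weight at s + 1 times the second. Summation
  by shifting the index leaves no boundary terms, because each coefficient vanishes at its end of
  the range.\<close>

lemma type_exp_stein: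
  fixes f :: "real \<Rightarrow> 'b :: real_vector"
  shows "type_exp n (\<lambda>k. (2 * k * (k - 1) * (k - 2)) *\<^sub>R f (k - 3)) =
         type_exp n (\<lambda>k. ((real n - k) * (real n - k - 3 / 2)) *\<^sub>R f k)"
proof -
  define M where "M = n div 3"
  define a where "a s = cycle_weight (n - 3 * s) (2 * s) / type_sum n" for s
  define p where "p k = 2 * k * (k - 1) * (k - 2)" for k :: real
  define q where "q k = (real n - k) * (real n - k - 3 / 2)" for k
  have step: "a s * p (real (n - 3 * s)) = a (Suc s) * q (real (n - 3 * Suc s))"
    "real (n - 3 * s) - 3 = real (n - 3 * Suc s)" if "s < M" for s
  proof -
    define j where "j = n - 3 * Suc s"
    have n: "n = j + 3 * Suc s" using that by (simp add: j_def M_def)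
    then have k: "n - 3 * s = Suc (Suc (Suc j))" by simp
    then show "real (n - 3 * s) - 3 = real (n - 3 * Suc s)" by (simp add: j_def)
    \<comment> \<open>Three 2-cycles contribute 2^3 (j+1)(j+2)(j+3), two 3-cycles contribute 3^2
      (2s+1)(2s+2); the coefficients of the identity are these two products divided by 4.\<close>
    have "cycle_weight (Suc (Suc (Suc j))) (2 * s) * (8 * (real j + 1) * (real j + 2) * (real j + 3)) = cycle_weight j (2 * s)"
      unfolding cycle_weight_Suc(1)[of j] cycle_weight_Suc(1)[of "Suc j"] cycle_weight_Suc(1)[of "Suc (Suc j)"]
      by (simp add: algebra_simps)
    also have "\<dots> = cycle_weight j (2 * Suc s) * (9 * (2 * real s + 1) * (2 * real s + 2))"
      using cycle_weight_Suc(2)[of j "2 * s"] cycle_weight_Suc(2)[of j "Suc (2 * s)"]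
      by (simp add: algebra_simps)
    finally have *: "cycle_weight (Suc (Suc (Suc j))) (2 * s) * (8 * (real j + 1) * (real j + 2) * (real j + 3)) =
      cycle_weight j (2 * Suc s) * (9 * (2 * real s + 1) * (2 * real s + 2))" .
    have "p (real (n - 3 * s)) = (8 * (real j + 1) * (real j + 2) * (real j + 3)) / 4"
      unfolding k p_def by (simp add: algebra_simps)
    moreover have "q (real (n - 3 * Suc s)) = (9 * (2 * real s + 1) * (2 * real s + 2)) / 4"
      unfolding q_def j_def[symmetric] n by (simp add: algebra_simps)
    ultimately show "a s * p (real (n - 3 * s)) = a (Suc s) * q (real (n - 3 * Suc s))"
      unfolding a_def k j_def[symmetric] by (simp only: times_divide_times_eq *)
  qed
  \<comment> \<open>At the last index fewer than three 2-cycles remain, so the first coefficient is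
    0; at s = 0 all cycles are 2-cycles, k = n, and the second one is 0.\<close>
  have "n - 3 * M \<in> {0, 1, 2}" by (auto simp: M_def)
  then have pM: "p (real (n - 3 * M)) = 0" by (auto simp: p_def)
  have "(\<Sum>s \<le> M. a s *\<^sub>R p (real (n - 3 * s)) *\<^sub>R f (real (n - 3 * s) - 3)) =
        (\<Sum>s < M. a s *\<^sub>R p (real (n - 3 * s)) *\<^sub>R f (real (n - 3 * s) - 3))"
    by (simp add: lessThan_Suc_atMost[symmetric] pM)
  also have "\<dots> = (\<Sum>s < M. a (Suc s) *\<^sub>R q (real (n - 3 * Suc s)) *\<^sub>R f (real (n - 3 * Suc s)))"
  proof (rule sum.cong[OF refl])
    fix s assume "s \<in> {..<M}"
    then have "s < M" by simp
    note st = step[OF this]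
    show "a s *\<^sub>R p (real (n - 3 * s)) *\<^sub>R f (real (n - 3 * s) - 3) =
      a (Suc s) *\<^sub>R q (real (n - 3 * Suc s)) *\<^sub>R f (real (n - 3 * Suc s))"
      unfolding scaleR_scaleR st ..
  qed
  also have "\<dots> = (\<Sum>s \<le> M. a s *\<^sub>R q (real (n - 3 * s)) *\<^sub>R f (real (n - 3 * s)))"
    by (subst sum.atMost_shift) (simp add: q_def)
  finally show ?thesis unfolding type_exp_def M_def a_def p_def q_def .
qed

section \<open>The centring point and its asymptotics\<close>

definition root_center :: "nat \<Rightarrow> real" where
  "root_center n = (SOME r. r > 0 \<and> 2 * r ^ 6 + 2 * real n * r\<^sup>2 = (real n)\<^sup>2)"

lemma root_center:
  assumes "n \<ge> 1"
  shows "root_center n > 0" "2 * root_center n ^ 6 + 2 * real n * (root_center n)\<^sup>2 = (real n)\<^sup>2"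
proof -
  have "\<exists>r \<ge> 0. r \<le> real n \<and> 2 * r ^ 6 + 2 * real n * r\<^sup>2 = (real n)\<^sup>2"
  proof (rule IVT')
    have "(1 :: real) \<le> real n" using assms by simp
    then have "(real n)\<^sup>2 * 1 \<le> (real n)\<^sup>2 * real n" by (intro mult_left_mono) auto
    moreover have "2 * real n * (real n)\<^sup>2 = 2 * ((real n)\<^sup>2 * real n)" by (simp add: mult_ac)
    moreover have "0 \<le> real n ^ 6" "0 \<le> (real n)\<^sup>2" by simp_all
    ultimately show "(real n)\<^sup>2 \<le> 2 * real n ^ 6 + 2 * real n * (real n)\<^sup>2"
      by linarith
  qed (auto intro!: continuous_intros)
  then obtain r where r: "r \<ge> 0" "2 * r ^ 6 + 2 * real n * r\<^sup>2 = (real n)\<^sup>2" by blast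
  have "r \<noteq> 0"
  proof
    assume "r = 0"
    then show False using r(2) assms by simp
  qed
  then have "\<exists>r. r > 0 \<and> 2 * r ^ 6 + 2 * real n * r\<^sup>2 = (real n)\<^sup>2"
    using r by (intro exI[of _ r]) simp
  from someI_ex[OF this]
  show "root_center n > 0" "2 * root_center n ^ 6 + 2 * real n * (root_center n)\<^sup>2 = (real n)\<^sup>2"
    by (auto simp: root_center_def)
qed

text \<open>A bounded quantity tending to sqrt 2 that eliminates n from the polynomial identities
  through n = v r^3; the equation for r becomes v^2 = 2 + 2v/r.\<close>

definition center_ratio :: "nat \<Rightarrow> real" where
  "center_ratio n = real n / root_center n ^ 3"

text \<open>With r < 1 the equation would give n^2 <= 2 + 2n, which is false from n = 3 on. This is
  the source of the hypothesis \<open>n \<ge> 3\<close> below; it makes 1/r at most 1.\<close>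

lemma root_center_ge_1:
  assumes "n \<ge> 3"
  shows "root_center n \<ge> 1"
proof (rule ccontr)
  let ?r = "root_center n"
  assume "\<not> ?r \<ge> 1"
  then have r: "0 < ?r" "?r < 1" using root_center(1)[of n] assms by auto
  then have "?r ^ 6 \<le> 1" "?r\<^sup>2 \<le> 1" by (simp_all add: power_le_one)
  moreover from this have "2 * real n * ?r\<^sup>2 \<le> 2 * real n * 1" by (intro mult_left_mono) auto
  ultimately have "(real n)\<^sup>2 \<le> 2 + 2 * real n"
    using root_center(2)[of n] assms by linarith
  moreover have "real n * real n \<ge> 3 * real n" using assms by (intro mult_right_mono) auto
  ultimately show False using assms by (simp add: power2_eq_square)
qed

lemma center_ratio:
  assumes "n \<ge> 3"
  shows "real n = center_ratio n * root_center n ^ 3"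
    "(center_ratio n)\<^sup>2 = 2 + 2 * center_ratio n / root_center n"
    "0 \<le> center_ratio n" "center_ratio n \<le> 3"
proof -
  let ?r = "root_center n" and ?v = "center_ratio n"
  have r: "?r \<ge> 1" "?r > 0" using root_center_ge_1[OF assms] by auto
  show n: "real n = ?v * ?r ^ 3" using r by (simp add: center_ratio_def)
  show v0: "0 \<le> ?v" using r by (simp add: center_ratio_def)
  have "?v\<^sup>2 * ?r ^ 6 = 2 * ?r ^ 6 + 2 * ?v * ?r ^ 5"
    using root_center(2)[of n] assms unfolding n
    by (simp add: power_mult_distrib algebra_simps flip: power_mult power_add)
  also have "\<dots> = (2 + 2 * ?v / ?r) * ?r ^ 6" using r by (simp add: field_simps power_numeral_reduce)
  finally show v: "?v\<^sup>2 = 2 + 2 * ?v / ?r" using r by simp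
  \<comment> \<open>With r >= 1 the quadratic gives v^2 <= 2 + 2v, hence v <= 1 + sqrt 3 <
    3.\<close>
  have "2 * ?v / ?r \<le> 2 * ?v / 1" using r v0 by (intro divide_left_mono) auto
  then have "?v * ?v \<le> 2 + 2 * ?v" using v by (simp add: power2_eq_square)
  show "?v \<le> 3"
  proof (rule ccontr)
    assume "\<not> ?v \<le> 3"
    then have "?v * ?v > 3 * ?v" by (intro mult_strict_right_mono) auto
    then show False using \<open>?v * ?v \<le> 2 + 2 * ?v\<close> \<open>\<not> ?v \<le> 3\<close> by linarith
  qed
qed

lemma root_center_at_top: "filterlim root_center at_top sequentially"
proof -
  have "filterlim (\<lambda>n. root_center n ^ 3) at_top sequentially"
  proof (rule filterlim_at_top_mono)
    show "filterlim (\<lambda>n. real n / 3) at_top sequentially" by real_asymp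
    show "\<forall>\<^sub>F n in sequentially. real n / 3 \<le> root_center n ^ 3"
      using eventually_ge_at_top[of 3]
    proof eventually_elim
      case (elim n)
      have "center_ratio n * root_center n ^ 3 \<le> 3 * root_center n ^ 3"
        using center_ratio(4)[OF elim] root_center_ge_1[OF elim] by (intro mult_right_mono) auto
      then show ?case using center_ratio(1)[OF elim] by simp
    qed
  qed
  then have "filterlim (\<lambda>n. root 3 (root_center n ^ 3)) at_top sequentially"
    by (rule filterlim_compose[rotated]) real_asymp
  then show ?thesis
    by (rule filterlim_cong[THEN iffD1, rotated -1])
      (auto intro!: eventually_mono[OF eventually_ge_at_top[of 3]] simp: real_root_power_cancel
        order_trans[OF _ root_center_ge_1])
qed

lemma center_ratio_tendsto: "(\<lambda>n. (center_ratio n)\<^sup>2) \<longlonglongrightarrow> 2"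
proof -
  have i: "(\<lambda>n. 1 / root_center n) \<longlonglongrightarrow> 0"
    using root_center_at_top by (simp add: tendsto_inverse_0_at_top flip: inverse_eq_divide)
  have "(\<lambda>n. 2 * center_ratio n / root_center n) \<longlonglongrightarrow> 0"
  proof (rule Lim_null_comparison)
    show "\<forall>\<^sub>F n in sequentially. norm (2 * center_ratio n / root_center n) \<le> 6 * (1 / root_center n)"
      using eventually_ge_at_top[of 3]
    proof eventually_elim
      case (elim n)
      show ?case using center_ratio(3,4)[OF elim] root_center_ge_1[OF elim] by (simp add: divide_right_mono)
    qed
    show "(\<lambda>n. 6 * (1 / root_center n)) \<longlonglongrightarrow> 0" using tendsto_mult_right[OF i, of 6] by simp
  qed
  then have "(\<lambda>n. 2 + 2 * center_ratio n / root_center n) \<longlonglongrightarrow> 2 + 0" by (intro tendsto_intros)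
  moreover have "\<forall>\<^sub>F n in sequentially. 2 + 2 * center_ratio n / root_center n = (center_ratio n)\<^sup>2"
    using eventually_ge_at_top[of 3] by eventually_elim (simp add: center_ratio(2))
  ultimately show ?thesis using Lim_transform_eventually by fastforce
qed

subsection \<open>Stein's identity and the fourth moment\<close>

definition center_exp :: "nat \<Rightarrow> (real \<Rightarrow> 'b) \<Rightarrow> 'b::real_vector" where
  "center_exp n G = type_exp n (\<lambda>k. G ((k - (root_center n)\<^sup>2) / root_center n))"

text \<open>Divide the difference of the two Stein coefficients by 6 r^5, subtract the main term y
  and multiply by r: this is the exact result, with all coefficients bounded in n. In the same way
  \<open>rate_rem\<close> is what the first coefficient divided by 6 r^6 leaves beyond its limit
  1/3.\<close>

definition drift_rem :: "nat \<Rightarrow> real \<Rightarrow> real" where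
  "drift_rem n y = (let u = 1 / root_center n; v = center_ratio n in
     y\<^sup>2 + u * y ^ 3 / 3 + v * y / 3 - 7 / 6 - 7 / 3 * u * y - 7 / 6 * u\<^sup>2 * y\<^sup>2 + v * u / 4
     + 5 / 12 * u\<^sup>2 + 5 / 12 * u ^ 3 * y)"

definition rate_rem :: "nat \<Rightarrow> real \<Rightarrow> real" where
  "rate_rem n y = (let u = 1 / root_center n in
     y + u * y\<^sup>2 + u\<^sup>2 * y ^ 3 / 3 - u * (1 + u * y)\<^sup>2 + 2 / 3 * u ^ 3 * (1 + u * y))"

lemma center_exp_const [simp]: "center_exp n (\<lambda>_. c) = c"
  by (simp add: center_exp_def)

lemma center_exp_add: "center_exp n (\<lambda>k. f k + g k) = center_exp n f + center_exp n g"
  by (simp add: center_exp_def type_exp_add)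

lemma center_exp_diff: "center_exp n (\<lambda>k. f k - g k) = center_exp n f - center_exp n g"
  by (simp add: center_exp_def type_exp_diff)

lemma center_exp_cmult:
  fixes f :: "real \<Rightarrow> 'b :: real_algebra"
  shows "center_exp n (\<lambda>k. c * f k) = c * center_exp n f"
  by (simp add: center_exp_def type_exp_cmult)

lemma center_exp_mono:
  fixes f :: "real \<Rightarrow> real"
  assumes "\<And>y. f y \<le> g y"
  shows "center_exp n f \<le> center_exp n g"
  unfolding center_exp_def by (rule type_exp_mono) (rule assms)

lemma norm_center_exp_bound:
  fixes f :: "real \<Rightarrow> 'b :: real_normed_vector"
  assumes "\<And>y. norm (f y) \<le> c * g y"
  shows "norm (center_exp n f) \<le> c * center_exp n g"
  unfolding center_exp_def by (rule norm_type_exp_bound) (rule assms)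

text \<open>Both are polynomial identities modulo u r = 1 and v^2 r = 2 r + 2 v. The second relation
  is the defining equation of r, and it is what removes the terms of orders r^6 and r^5 free of
  y.\<close>

lemma stein_coefficients:
  assumes n: "n \<ge> 3"
  defines "r \<equiv> root_center n"
  shows "2 * k * (k - 1) * (k - 2) = 6 * r ^ 6 * (1 / 3 + 1 / r * rate_rem n ((k - r\<^sup>2) / r))"
    and "2 * k * (k - 1) * (k - 2) - (real n - k) * (real n - k - 3 / 2) =
      6 * r ^ 5 * ((k - r\<^sup>2) / r + 1 / r * drift_rem n ((k - r\<^sup>2) / r))"
proof -
  define u where "u = 1 / r"
  define v where "v = center_ratio n"
  define y where "y = (k - r\<^sup>2) / r"
  have r: "r \<ge> 1" using root_center_ge_1[OF n] by (simp add: r_def)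
  have ur: "u * r = 1" using r by (simp add: u_def)
  have k: "k = r\<^sup>2 + r * y" using r by (simp add: y_def)
  have N: "real n = v * r ^ 3" using center_ratio(1)[OF n] by (simp add: v_def r_def)
  have v: "v\<^sup>2 * r = 2 * r + 2 * v"
    using center_ratio(2)[OF n] r by (simp add: v_def r_def field_simps)
  have "2 * k * (k - 1) * (k - 2) = 6 * r ^ 6 * (1 / 3 + u *
      (y + u * y\<^sup>2 + u\<^sup>2 * y ^ 3 / 3 - u * (1 + u * y)\<^sup>2 + 2 / 3 * u ^ 3 * (1 + u * y)))"
    using ur unfolding k by algebra
  then show "2 * k * (k - 1) * (k - 2) = 6 * r ^ 6 * (1 / 3 + 1 / r * rate_rem n ((k - r\<^sup>2) / r))"
    by (simp only: rate_rem_def Let_def r_def[symmetric] u_def[symmetric] y_def[symmetric])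
  have "2 * k * (k - 1) * (k - 2) - (v * r ^ 3 - k) * (v * r ^ 3 - k - 3 / 2) =
      6 * r ^ 5 * (y + u * (y\<^sup>2 + u * y ^ 3 / 3 + v * y / 3 - 7 / 6 - 7 / 3 * u * y - 7 / 6 * u\<^sup>2 * y\<^sup>2 + v * u / 4
     + 5 / 12 * u\<^sup>2 + 5 / 12 * u ^ 3 * y))"
    using ur v unfolding k by algebra
  then show "2 * k * (k - 1) * (k - 2) - (real n - k) * (real n - k - 3 / 2) =
      6 * r ^ 5 * ((k - r\<^sup>2) / r + 1 / r * drift_rem n ((k - r\<^sup>2) / r))"
    by (simp only: N drift_rem_def Let_def r_def[symmetric] u_def[symmetric] y_def[symmetric] v_def[symmetric])
qed

text \<open>Both sides of the identity for k are subtracted from E[2k(k-1)(k-2) f(k)], and the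
  result is divided by 6 r^5. A shift of k by 3 is a shift of y by 3/r, so (r/3)(G(y) - G(y - 3/r))
  is a difference quotient standing for G'(y).\<close>

lemma center_exp_stein:
  fixes G :: "real \<Rightarrow> 'b :: real_vector"
  assumes n: "n \<ge> 3"
  defines "r \<equiv> root_center n"
  shows "center_exp n (\<lambda>y. (y + 1 / r * drift_rem n y) *\<^sub>R G y) =
         center_exp n (\<lambda>y. ((1 / 3 + 1 / r * rate_rem n y) * r) *\<^sub>R (G y - G (y - 3 / r)))"
proof -
  have r: "r > 0" using root_center(1) n by (simp add: r_def)
  define f where "f k = G ((k - r\<^sup>2) / r)" for k
  define p where "p k = 2 * k * (k - 1) * (k - 2)" for k :: real
  define q where "q k = (real n - k) * (real n - k - 3 / 2)" for k
  note sc = stein_coefficients[OF n, folded r_def p_def q_def]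
  have sh: "f (k - 3) = G ((k - r\<^sup>2) / r - 3 / r)" for k
    by (simp add: f_def diff_divide_distrib add_divide_distrib algebra_simps)
  have "type_exp n (\<lambda>k. p k *\<^sub>R f (k - 3)) = type_exp n (\<lambda>k. q k *\<^sub>R f k)"
    using type_exp_stein[of n f] by (simp only: p_def q_def)
  then have "type_exp n (\<lambda>k. p k *\<^sub>R f k) - type_exp n (\<lambda>k. q k *\<^sub>R f k) =
    type_exp n (\<lambda>k. p k *\<^sub>R f k) - type_exp n (\<lambda>k. p k *\<^sub>R f (k - 3))" by simp
  then have "type_exp n (\<lambda>k. (p k - q k) *\<^sub>R f k) = type_exp n (\<lambda>k. p k *\<^sub>R (f k - f (k - 3)))"
    by (simp only: scaleR_diff_left scaleR_diff_right type_exp_diff)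
  moreover have "type_exp n (\<lambda>k. (p k - q k) *\<^sub>R f k) =
      (6 * r ^ 5) *\<^sub>R type_exp n (\<lambda>k. ((k - r\<^sup>2) / r + 1 / r * drift_rem n ((k - r\<^sup>2) / r)) *\<^sub>R f k)"
    by (simp only: sc(2) type_exp_scaleR[symmetric] scaleR_scaleR)
  moreover have "type_exp n (\<lambda>k. p k *\<^sub>R (f k - f (k - 3))) =
      (6 * r ^ 6) *\<^sub>R type_exp n (\<lambda>k. (1 / 3 + 1 / r * rate_rem n ((k - r\<^sup>2) / r)) *\<^sub>R (f k - f (k - 3)))"
    by (simp only: sc(1) type_exp_scaleR[symmetric] scaleR_scaleR)
  ultimately have "(6 * r ^ 5) *\<^sub>R type_exp n (\<lambda>k. ((k - r\<^sup>2) / r + 1 / r * drift_rem n ((k - r\<^sup>2) / r)) *\<^sub>R f k) =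
    (6 * r ^ 6) *\<^sub>R type_exp n (\<lambda>k. (1 / 3 + 1 / r * rate_rem n ((k - r\<^sup>2) / r)) *\<^sub>R (f k - f (k - 3)))"
    by simp
  also have "6 * r ^ 6 = (6 * r ^ 5) * r" by (simp add: power_numeral_reduce)
  finally have "(6 * r ^ 5) *\<^sub>R type_exp n (\<lambda>k. ((k - r\<^sup>2) / r + 1 / r * drift_rem n ((k - r\<^sup>2) / r)) *\<^sub>R f k) =
    (6 * r ^ 5) *\<^sub>R type_exp n (\<lambda>k. ((1 / 3 + 1 / r * rate_rem n ((k - r\<^sup>2) / r)) * r) *\<^sub>R (f k - f (k - 3)))"
    by (simp only: type_exp_scaleR[symmetric] scaleR_scaleR mult_ac)
  then have "type_exp n (\<lambda>k. ((k - r\<^sup>2) / r + 1 / r * drift_rem n ((k - r\<^sup>2) / r)) *\<^sub>R f k) =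
    type_exp n (\<lambda>k. ((1 / 3 + 1 / r * rate_rem n ((k - r\<^sup>2) / r)) * r) *\<^sub>R (f k - f (k - 3)))"
    using r by simp
  then show ?thesis unfolding sh unfolding f_def center_exp_def r_def .
qed

lemma abs_le_1_cube: "\<bar>y\<bar> ^ a \<le> 1 + \<bar>y\<bar> ^ 3" if "a \<le> 3" for y :: real
proof (cases "\<bar>y\<bar> \<le> 1")
  case True
  then have "\<bar>y\<bar> ^ a \<le> 1" by (simp add: power_le_one)
  then show ?thesis by (simp add: add_increasing2)
next
  case False
  then have "\<bar>y\<bar> ^ a \<le> \<bar>y\<bar> ^ 3" using that by (intro power_increasing) auto
  then show ?thesis by simp
qed

lemma abs_coeff_le:
  fixes c y :: real
  assumes "\<bar>c\<bar> \<le> C" "a \<le> 3"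
  shows "\<bar>c * y ^ a\<bar> \<le> C * (1 + \<bar>y\<bar> ^ 3)"
  using mult_mono[OF assms(1) abs_le_1_cube[OF assms(2), of y]] assms(1)
  by (simp add: abs_mult power_abs)

lemma abs_sum4_le: "\<bar>a + b + c + d\<bar> \<le> \<bar>a\<bar> + \<bar>b\<bar> + \<bar>c\<bar> + \<bar>d\<bar>" for a b c d :: real
  by linarith

text \<open>Sorted by powers of y, the coefficients have absolute values at most 3, 5, 3 and 1 for u
  in [0,1] and v in [0,3]. The constant 20 is rounded up so that it also serves
  \<open>rate_rem\<close>.\<close>

lemma drift_rem_bound:
  assumes n: "n \<ge> 3"
  shows "\<bar>drift_rem n y\<bar> \<le> 20 * (1 + \<bar>y\<bar> ^ 3)"
proof -
  define u where "u = 1 / root_center n"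
  define v where "v = center_ratio n"
  have u: "0 \<le> u" "u \<le> 1" using root_center_ge_1[OF n] by (simp_all add: u_def)
  have up: "u ^ a \<le> 1" for a using u by (simp add: power_le_one)
  have v: "0 \<le> v" "v \<le> 3" using center_ratio(3,4)[OF n] by (simp_all add: v_def)
  have vu: "v * u \<le> 3 * 1" using u v by (intro mult_mono) auto
  have eq: "drift_rem n y = (v * u / 4 + 5 / 12 * u\<^sup>2 - 7 / 6) * y ^ 0 +
    (v / 3 - 7 / 3 * u + 5 / 12 * u ^ 3) * y ^ 1 + (1 - 7 / 6 * u\<^sup>2) * y ^ 2 + u / 3 * y ^ 3"
    unfolding drift_rem_def Let_def u_def[symmetric] v_def[symmetric] by (simp add: algebra_simps)
  have "\<bar>drift_rem n y\<bar> \<le> 3 * (1 + \<bar>y\<bar> ^ 3) + 5 * (1 + \<bar>y\<bar> ^ 3) + 3 * (1 + \<bar>y\<bar> ^ 3) + 1 * (1 + \<bar>y\<bar> ^ 3)"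
    unfolding eq
  proof (intro order_trans[OF abs_sum4_le] add_mono abs_coeff_le)
    show "\<bar>v * u / 4 + 5 / 12 * u\<^sup>2 - 7 / 6\<bar> \<le> 3"
      using u v vu up[of 2] zero_le_power[OF u(1), of 2] mult_nonneg_nonneg[OF v(1) u(1)] by linarith
    show "\<bar>v / 3 - 7 / 3 * u + 5 / 12 * u ^ 3\<bar> \<le> 5"
      using u v up[of 3] zero_le_power[OF u(1), of 3] by linarith
    show "\<bar>1 - 7 / 6 * u\<^sup>2\<bar> \<le> 3"
      using up[of 2] zero_le_power[OF u(1), of 2] by linarith
  qed (use u in auto)
  also have "\<dots> \<le> 20 * (1 + \<bar>y\<bar> ^ 3)" by simp
  finally show ?thesis .
qed

lemma rate_rem_bound:
  assumes n: "n \<ge> 3"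
  shows "\<bar>rate_rem n y\<bar> \<le> 20 * (1 + \<bar>y\<bar> ^ 3)"
proof -
  define u where "u = 1 / root_center n"
  have u: "0 \<le> u" "u \<le> 1" using root_center_ge_1[OF n] by (simp_all add: u_def)
  have up: "u ^ a \<le> 1" "0 \<le> u ^ a" for a using u by (simp_all add: power_le_one)
  have eq: "rate_rem n y = (2 / 3 * u ^ 3 - u) * y ^ 0 +
    (1 - 2 * u\<^sup>2 + 2 / 3 * u ^ 4) * y ^ 1 + (u - u ^ 3) * y ^ 2 + u\<^sup>2 / 3 * y ^ 3"
    unfolding rate_rem_def Let_def u_def[symmetric] by (simp add: algebra_simps power2_eq_square power_numeral_reduce)
  have "\<bar>rate_rem n y\<bar> \<le> 2 * (1 + \<bar>y\<bar> ^ 3) + 4 * (1 + \<bar>y\<bar> ^ 3) + 2 * (1 + \<bar>y\<bar> ^ 3) + 1 * (1 + \<bar>y\<bar> ^ 3)"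
    unfolding eq
  proof (intro order_trans[OF abs_sum4_le] add_mono abs_coeff_le)
    show "\<bar>2 / 3 * u ^ 3 - u\<bar> \<le> 2"
      using u up[of 3] by linarith
    show "\<bar>1 - 2 * u\<^sup>2 + 2 / 3 * u ^ 4\<bar> \<le> 4"
      using up[of 2] up[of 4] by linarith
    show "\<bar>u - u ^ 3\<bar> \<le> 2"
      using u up[of 3] by linarith
    show "\<bar>u\<^sup>2 / 3\<bar> \<le> 1" using up[of 2] by simp
  qed auto
  also have "\<dots> \<le> 20 * (1 + \<bar>y\<bar> ^ 3)" by simp
  finally show ?thesis .
qed

(* Read \<kappa> = k / r^2 and P = 2 k (k - 1) (k - 2) / r^6; the constant is far from optimal. *)
lemma fourth_moment_polynomial:
  fixes y \<kappa> u v P :: real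
  assumes u: "0 \<le> u" "u \<le> 1" and v: "0 \<le> v" "v \<le> 3" and \<kappa>: "\<kappa> = 1 + u * y" "0 \<le> \<kappa>"
    and P: "0 \<le> P" "P \<le> 2 * \<kappa> ^ 3"
  shows "y ^ 4 - 2 * 10 ^ 8 \<le>
    (2 * y * (\<kappa>\<^sup>2 + \<kappa> + 1) + 2 * v * u * y - 7 * \<kappa>\<^sup>2 * u + 3 / 2 * v * u\<^sup>2 + 5 / 2 * \<kappa> * u ^ 3) * y ^ 3
    - P * (9 * y\<^sup>2 - 27 * u * y + 27 * u\<^sup>2)"
proof -
  define z where "z = \<bar>y\<bar>"
  have z: "0 \<le> z" by (simp add: z_def)
  have zy: "z ^ 4 = y ^ 4" "z\<^sup>2 = y\<^sup>2" by (simp_all add: z_def power_even_abs)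
  have z3: "\<bar>y ^ 3\<bar> = z ^ 3" by (simp add: z_def power_abs)
  have up: "u ^ a \<le> 1" "0 \<le> u ^ a" for a using u by (simp_all add: power_le_one)
  have uy: "\<bar>u * y\<bar> \<le> z" using u by (simp add: z_def abs_mult mult_left_le_one_le)
  have \<kappa>z: "\<kappa> \<le> 1 + z" using \<kappa>(1) uy by linarith
  \<comment> \<open>An even power with a nonnegative coefficient: this term has the good sign and is
    dropped.\<close>
  have a1: "2 * v * u * y * y ^ 3 \<ge> 0"
  proof -
    have "2 * v * u * y * y ^ 3 = 2 * v * u * y ^ 4" by (simp add: power_numeral_reduce)
    also have "\<dots> \<ge> 0" using u v by simp
    finally show ?thesis .
  qed
  have le3: "- (c * z ^ 3) \<le> d * y ^ 3" if "\<bar>d\<bar> \<le> c" for c d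
  proof -
    have "\<bar>d * y ^ 3\<bar> \<le> c * z ^ 3" using that z by (simp add: abs_mult z3 mult_right_mono)
    then show ?thesis by linarith
  qed
  have a2: "- (7 * \<kappa>\<^sup>2 * z ^ 3) \<le> (- 7 * \<kappa>\<^sup>2 * u) * y ^ 3"
    using u by (intro le3) (simp add: abs_mult mult_left_le)
  have a3: "- (9 / 2 * z ^ 3) \<le> (3 / 2 * v * u\<^sup>2) * y ^ 3"
  proof (rule le3)
    have "v * u\<^sup>2 \<le> 3 * 1" using v up[of 2] by (intro mult_mono) auto
    then show "\<bar>3 / 2 * v * u\<^sup>2\<bar> \<le> 9 / 2" using v by (simp add: abs_mult)
  qed
  have a4: "- (5 / 2 * \<kappa> * z ^ 3) \<le> (5 / 2 * \<kappa> * u ^ 3) * y ^ 3"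
    using up[of 3] \<kappa>(2) by (intro le3) (simp add: abs_mult mult_left_le)
  have w: "9 * y\<^sup>2 - 27 * u * y + 27 * u\<^sup>2 \<le> 9 * z\<^sup>2 + 27 * z + 27" (is "?w \<le> ?W")
    using uy up[of 2] by (simp add: zy)
  have W0: "0 \<le> ?W" using z by simp
  have a5: "P * ?w \<le> 2 * \<kappa> ^ 3 * ?W"
    using mult_left_mono[OF w P(1)] mult_right_mono[OF P(2) W0] by linarith
  \<comment> \<open>All signs of y are now resolved to the worst case, leaving an inequality in z =
    |y| and \<kappa>.\<close>
  have main: "2 * z ^ 4 * (\<kappa>\<^sup>2 + \<kappa> + 1) - 7 * \<kappa>\<^sup>2 * z ^ 3 - 9 / 2 * z ^ 3 - 5 / 2 * \<kappa> * z ^ 3 - 2 * \<kappa> ^ 3 * ?W \<le>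
    (2 * y * (\<kappa>\<^sup>2 + \<kappa> + 1) + 2 * v * u * y - 7 * \<kappa>\<^sup>2 * u + 3 / 2 * v * u\<^sup>2 + 5 / 2 * \<kappa> * u ^ 3) * y ^ 3 - P * ?w"
  proof -
    have yy: "y * y ^ 3 = z ^ 4" unfolding zy by (simp add: power_numeral_reduce)
    have "(2 * y * (\<kappa>\<^sup>2 + \<kappa> + 1) + 2 * v * u * y - 7 * \<kappa>\<^sup>2 * u + 3 / 2 * v * u\<^sup>2 + 5 / 2 * \<kappa> * u ^ 3) * y ^ 3 =
      2 * (y * y ^ 3) * (\<kappa>\<^sup>2 + \<kappa> + 1) + 2 * v * u * y * y ^ 3 + (- 7 * \<kappa>\<^sup>2 * u) * y ^ 3
      + (3 / 2 * v * u\<^sup>2) * y ^ 3 + (5 / 2 * \<kappa> * u ^ 3) * y ^ 3" by (simp only: algebra_simps)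
    then show ?thesis using a1 a2 a3 a4 a5 unfolding yy by linarith
  qed
  have "z ^ 4 - 2 * 10 ^ 8 \<le> 2 * z ^ 4 * (\<kappa>\<^sup>2 + \<kappa> + 1) - 7 * \<kappa>\<^sup>2 * z ^ 3 - 9 / 2 * z ^ 3 - 5 / 2 * \<kappa> * z ^ 3 - 2 * \<kappa> ^ 3 * ?W"
  \<comment> \<open>\<kappa> has no bound independent of r, so its powers must be matched. For large
    z the cubic power is lowered by \<kappa> <= 1 + z. Then the \<kappa>^2 part of the leading term
    absorbs all \<kappa>^2 terms, the \<kappa> part absorbs the \<kappa> term, and the constant part
    2 z^4 absorbs 9/2 z^3 with z^4 to spare.\<close>
  proof (cases "z \<ge> 20")
    case True
    have zz: "20 * z \<le> z * z" "20 * z\<^sup>2 \<le> z * z\<^sup>2" "20 * z ^ 3 \<le> z * z ^ 3"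
      using True z by (intro mult_right_mono; simp)+
    have e: "z * z = z\<^sup>2" "z * z\<^sup>2 = z ^ 3" "z * z ^ 3 = z ^ 4" by (simp_all add: power_numeral_reduce)
    note zz' = zz[unfolded e]
    have "2 * \<kappa> ^ 3 * ?W = 2 * \<kappa>\<^sup>2 * ?W * \<kappa>" by (simp add: power_numeral_reduce)
    also have "\<dots> \<le> 2 * \<kappa>\<^sup>2 * ?W * (1 + z)" using W0 \<kappa>z by (intro mult_left_mono) auto
    finally have 1: "2 * \<kappa> ^ 3 * ?W \<le> \<kappa>\<^sup>2 * (2 * ?W * (1 + z))" by (simp only: mult_ac)
    have "2 * ?W * (1 + z) + 7 * z ^ 3 = 25 * z ^ 3 + 72 * z\<^sup>2 + 108 * z + 54"
      by (simp add: algebra_simps power_numeral_reduce)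
    also have "\<dots> \<le> 2 * z ^ 4" using zz' True by linarith
    finally have 2: "\<kappa>\<^sup>2 * (2 * ?W * (1 + z) + 7 * z ^ 3) \<le> \<kappa>\<^sup>2 * (2 * z ^ 4)" by (intro mult_left_mono) auto
    have 3: "\<kappa> * (5 / 2 * z ^ 3) \<le> \<kappa> * (2 * z ^ 4)" using zz' z by (intro mult_left_mono \<kappa>(2)) auto
    have 4: "9 / 2 * z ^ 3 \<le> z ^ 4" using zz' z by (simp add: mult_nonneg_nonneg)
    show ?thesis using 1 2 3 4 by (simp add: algebra_simps)
  next
    case False
    \<comment> \<open>On the bounded range z <= 20, \<kappa> <= 21 every term is bounded by a
      number; together these stay below 2 * 10^8, which is where that constant comes from.\<close>
    then have z20: "z \<le> 20" by simp
    have k21: "\<kappa> \<le> 21" using \<kappa>z z20 by linarith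
    have zp: "z ^ a \<le> 20 ^ a" "0 \<le> z ^ a" for a using z z20 by (auto intro: power_mono)
    have kp: "\<kappa> ^ a \<le> 21 ^ a" "0 \<le> \<kappa> ^ a" for a using \<kappa>(2) k21 by (auto intro: power_mono)
    have b1: "\<kappa>\<^sup>2 * z ^ 3 \<le> 21\<^sup>2 * 20 ^ 3" by (intro mult_mono zp kp) simp
    have b2: "\<kappa> * z ^ 3 \<le> 21 * 20 ^ 3" by (intro mult_mono zp k21) simp
    have "?W \<le> 4200" using zp(1)[of 2] z20 by simp
    then have b3: "\<kappa> ^ 3 * ?W \<le> 21 ^ 3 * 4200" by (intro mult_mono kp W0) simp_all
    have b4: "2 * z ^ 4 * (\<kappa>\<^sup>2 + \<kappa> + 1) \<ge> 0" using z \<kappa>(2) by simp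
    show ?thesis using b1 b2 b3 b4 zp[of 3] zp[of 4] by (simp add: mult_ac)
  qed
  then show ?thesis using main by (simp add: zy)
qed

text \<open>With G(y) = y^3 the Stein identity says that B has expectation 0, and y^4 minus a
  constant lies below B at every attained value. The exact coefficients are kept, because the cubic
  bounds on the remainders would ask for a sixth moment.\<close>

lemma center_exp_fourth_moment:
  assumes n: "n \<ge> 3"
  shows "center_exp n (\<lambda>y. y ^ 4) \<le> 2 * 10 ^ 8"
proof -
  define r where "r = root_center n"
  define u where "u = 1 / r"
  define v where "v = center_ratio n"
  have r: "r \<ge> 1" using root_center_ge_1[OF n] by (simp add: r_def)
  have u: "0 \<le> u" "u \<le> 1" using r by (simp_all add: u_def)
  have ur: "u * r = 1" using r by (simp add: u_def)
  have v: "0 \<le> v" "v \<le> 3" using center_ratio(3,4)[OF n] by (simp_all add: v_def)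
  define B where "B y = 6 * (y + u * drift_rem n y) * y ^ 3 - 6 * (1 / 3 + u * rate_rem n y) * (9 * y\<^sup>2 - 27 * u * y + 27 * u\<^sup>2)" for y
  have pw: "((k - r\<^sup>2) / r) ^ 4 - 2 * 10 ^ 8 \<le> B ((k - r\<^sup>2) / r)" if k: "k = real j" for k j
  proof -
    define y where "y = (k - r\<^sup>2) / r"
    define \<kappa> where "\<kappa> = 1 + u * y"
    have ky: "k = r\<^sup>2 + r * y" using r by (simp add: y_def)
    have \<kappa>: "k = r\<^sup>2 * \<kappa>" unfolding \<kappa>_def ky using ur by algebra
    have \<kappa>0: "\<kappa> \<ge> 0" 
    proof -
      have "0 \<le> r\<^sup>2 * \<kappa>" using \<kappa> k by simp
      then show ?thesis using r by (simp add: zero_le_mult_iff)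
    qed
    \<comment> \<open>Here k must be a natural number: the falling factorial is 0 at 0 and 1 and has
      nonnegative factors from 2 on.\<close>
    have k3: "0 \<le> 2 * k * (k - 1) * (k - 2)" "2 * k * (k - 1) * (k - 2) \<le> 2 * k ^ 3"
    proof -
      consider "j = 0" | "j = 1" | "j \<ge> 2" by linarith
      then have "0 \<le> 2 * k * (k - 1) * (k - 2) \<and> 2 * k * (k - 1) * (k - 2) \<le> 2 * k ^ 3"
      proof cases
        case 3
        then have "k \<ge> 2" using k by simp
        then have "0 \<le> k * ((k - 1) * (k - 2))" "k * ((k - 1) * (k - 2)) \<le> k * (k * k)"
          by (auto intro!: mult_nonneg_nonneg mult_left_mono mult_mono)
        moreover have "2 * k * (k - 1) * (k - 2) = 2 * (k * ((k - 1) * (k - 2)))" "2 * k ^ 3 = 2 * (k * (k * k))"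
          by (simp_all only: mult.assoc power3_eq_cube)
        ultimately show ?thesis by linarith
      qed (simp_all add: k)
      then show "0 \<le> 2 * k * (k - 1) * (k - 2)" "2 * k * (k - 1) * (k - 2) \<le> 2 * k ^ 3" by auto
    qed
    note sc = stein_coefficients[OF n, of k, folded r_def u_def y_def]
    define P where "P = 6 * (1 / 3 + u * rate_rem n y)"
    have "2 * k * (k - 1) * (k - 2) = r ^ 6 * P" unfolding sc(1) P_def by (simp add: u_def y_def)
    moreover have "2 * k ^ 3 = r ^ 6 * (2 * \<kappa> ^ 3)"
      unfolding \<kappa> by (simp add: power_mult_distrib flip: power_mult)
    ultimately have "0 \<le> r ^ 6 * P" "r ^ 6 * P \<le> r ^ 6 * (2 * \<kappa> ^ 3)"
      using k3 by (simp_all only:)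
    then have P: "0 \<le> P" "P \<le> 2 * \<kappa> ^ 3" using r by (simp_all add: zero_le_mult_iff)
    \<comment> \<open>The leading part is 2 r^6 (\<kappa>^3 - 1), and since \<kappa> - 1 = u y it
      factors as 2 r^5 y (\<kappa>^2 + \<kappa> + 1). This exhibits y times a positive factor,
      pulling towards the centre for all \<kappa> >= 0.\<close>
    have "6 * (y + u * drift_rem n y) = 2 * y * (\<kappa>\<^sup>2 + \<kappa> + 1) + 2 * v * u * y - 7 * \<kappa>\<^sup>2 * u + 3 / 2 * v * u\<^sup>2 + 5 / 2 * \<kappa> * u ^ 3"
      unfolding drift_rem_def Let_def u_def[unfolded r_def, symmetric] v_def[symmetric] \<kappa>_def
      by (simp add: algebra_simps power_numeral_reduce)
    then have "B y = (2 * y * (\<kappa>\<^sup>2 + \<kappa> + 1) + 2 * v * u * y - 7 * \<kappa>\<^sup>2 * u + 3 / 2 * v * u\<^sup>2 + 5 / 2 * \<kappa> * u ^ 3) * y ^ 3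
      - P * (9 * y\<^sup>2 - 27 * u * y + 27 * u\<^sup>2)"
      by (simp add: B_def P_def)
    then show ?thesis
      using fourth_moment_polynomial[OF u v \<kappa>_def \<kappa>0 P] unfolding y_def[symmetric] by simp
  qed
  have diff: "y ^ 3 - (y - 3 / r) ^ 3 = u * (9 * y\<^sup>2 - 27 * u * y + 27 * u\<^sup>2)" for y
  proof -
    have "3 / r = 3 * u" by (simp add: u_def)
    then show ?thesis by (simp add: algebra_simps power_numeral_reduce)
  qed
  have eq: "((1 / 3 + u * rate_rem n y) * r) *\<^sub>R (y ^ 3 - (y - 3 / r) ^ 3) =
      (1 / 3 + u * rate_rem n y) * (9 * y\<^sup>2 - 27 * u * y + 27 * u\<^sup>2)" for y
    unfolding diff using ur by (simp add: mult_ac)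
  have "center_exp n (\<lambda>y. (y + u * drift_rem n y) * y ^ 3) =
     center_exp n (\<lambda>y. (1 / 3 + u * rate_rem n y) * (9 * y\<^sup>2 - 27 * u * y + 27 * u\<^sup>2))"
    using center_exp_stein[OF n, of "\<lambda>y. y ^ 3", folded r_def, folded u_def]
    unfolding eq by (simp only: real_scaleR_def)
  then have "center_exp n B = 0"
    unfolding B_def mult.assoc center_exp_diff center_exp_cmult by simp
  moreover have "center_exp n (\<lambda>y. y ^ 4 - 2 * 10 ^ 8) \<le> center_exp n B"
    unfolding center_exp_def r_def[symmetric] by (rule type_exp_mono) (rule pw, rule refl)
  ultimately show ?thesis by (simp add: center_exp_diff)
qed

subsection \<open>Moments and characteristic function\<close>

text \<open>The two error budgets: the first for a remainder times a bounded test function, the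
  second for a remainder times y. By the fourth moment they are at most 2 + 2 * 10^8 and 1 + 4 *
  10^8.\<close>

lemma center_exp_cube: 
  assumes "n \<ge> 3"
  shows "center_exp n (\<lambda>y. 1 + \<bar>y\<bar> ^ 3) \<le> 10 ^ 9" "center_exp n (\<lambda>y. (1 + \<bar>y\<bar> ^ 3) * \<bar>y\<bar>) \<le> 10 ^ 9"
proof -
  have p: "\<bar>y\<bar> ^ a \<le> 1 + y ^ 4" if "a \<le> 4" for y :: real and a
  proof (cases "\<bar>y\<bar> \<le> 1")
    case True
    then have "\<bar>y\<bar> ^ a \<le> 1" by (simp add: power_le_one)
    then show ?thesis by (simp add: add_increasing2)
  next
    case False
    then have "\<bar>y\<bar> ^ a \<le> \<bar>y\<bar> ^ 4" using that by (intro power_increasing) auto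
    then show ?thesis by (simp add: power_even_abs)
  qed
  have "center_exp n (\<lambda>y. 1 + \<bar>y\<bar> ^ 3) \<le> center_exp n (\<lambda>y. 2 + y ^ 4)"
    by (rule center_exp_mono) (use p[of 3] in simp)
  then show "center_exp n (\<lambda>y. 1 + \<bar>y\<bar> ^ 3) \<le> 10 ^ 9"
    using center_exp_fourth_moment[OF assms] by (simp add: center_exp_add)
  have "(1 + \<bar>y\<bar> ^ 3) * \<bar>y\<bar> \<le> 1 + 2 * y ^ 4" for y :: real
  proof -
    have "(1 + \<bar>y\<bar> ^ 3) * \<bar>y\<bar> = \<bar>y\<bar> + \<bar>y\<bar> ^ 4" by (simp add: algebra_simps power_numeral_reduce)
    then show ?thesis using p[of 1 y] by (simp add: power_even_abs)
  qed
  then have "center_exp n (\<lambda>y. (1 + \<bar>y\<bar> ^ 3) * \<bar>y\<bar>) \<le> center_exp n (\<lambda>y. 1 + 2 * y ^ 4)"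
    by (rule center_exp_mono)
  then show "center_exp n (\<lambda>y. (1 + \<bar>y\<bar> ^ 3) * \<bar>y\<bar>) \<le> 10 ^ 9"
    using center_exp_fourth_moment[OF assms] by (simp add: center_exp_add center_exp_cmult)
qed

text \<open>For constant G the difference side vanishes, so the mean of y is exactly -1/r times the
  mean of \<open>drift_rem\<close>. In terms of k, the centre r^2 misses the mean by O(1)
  only.\<close>

lemma center_exp_mean:
  assumes n: "n \<ge> 3"
  shows "\<bar>center_exp n (\<lambda>y. y)\<bar> \<le> 20 * 10 ^ 9 * (1 / root_center n)"
proof -
  define u where "u = 1 / root_center n"
  have u: "0 \<le> u" using root_center_ge_1[OF n] by (simp add: u_def)
  have "center_exp n (\<lambda>y. y + u * drift_rem n y) = 0"
    using center_exp_stein[OF n, of "\<lambda>_. 1 :: real"] by (simp add: u_def)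
  then have "center_exp n (\<lambda>y. y) = - u * center_exp n (drift_rem n)"
    by (simp add: center_exp_add center_exp_cmult)
  moreover have "norm (center_exp n (drift_rem n)) \<le> 20 * center_exp n (\<lambda>y. 1 + \<bar>y\<bar> ^ 3)"
    by (rule norm_center_exp_bound) (unfold real_norm_def, rule drift_rem_bound[OF n])
  then have "\<bar>center_exp n (drift_rem n)\<bar> \<le> 20 * 10 ^ 9" using center_exp_cube(1)[OF n] by simp
  ultimately show ?thesis using u mult_left_mono[of "\<bar>center_exp n (drift_rem n)\<bar>" "20 * 10 ^ 9" u]
    by (simp add: abs_mult u_def[symmetric] mult_ac)
qed

text \<open>For G(y) = y the difference is exactly 3/r, so only the two remainders contribute, with
  constant 3 * 20 + 20.\<close>

lemma center_exp_second_moment: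
  assumes n: "n \<ge> 3"
  shows "\<bar>center_exp n (\<lambda>y. y\<^sup>2) - 1\<bar> \<le> 80 * 10 ^ 9 * (1 / root_center n)"
proof -
  define u where "u = 1 / root_center n"
  have r: "root_center n \<ge> 1" using root_center_ge_1[OF n] .
  then have u: "0 \<le> u" by (simp add: u_def)
  have "(1 / 3 + u * rate_rem n y) * root_center n * (y - (y - 3 / root_center n)) = 1 + 3 * u * rate_rem n y" for y
    using r by (simp add: algebra_simps)
  then have "center_exp n (\<lambda>y. (y + u * drift_rem n y) * y) = center_exp n (\<lambda>y. 1 + 3 * u * rate_rem n y)"
    using center_exp_stein[OF n, of "\<lambda>y. y", folded u_def] by (simp only: real_scaleR_def)
  moreover have "(\<lambda>y. (y + u * drift_rem n y) * y) = (\<lambda>y. y\<^sup>2 + u * (drift_rem n y * y))"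
    by (simp add: fun_eq_iff algebra_simps power2_eq_square)
  ultimately have "center_exp n (\<lambda>y. y\<^sup>2) + u * center_exp n (\<lambda>y. drift_rem n y * y) = 1 + 3 * u * center_exp n (rate_rem n)"
    by (simp only: center_exp_add center_exp_cmult center_exp_const)
  then have eq: "center_exp n (\<lambda>y. y\<^sup>2) - 1 = u * (3 * center_exp n (rate_rem n) - center_exp n (\<lambda>y. drift_rem n y * y))"
    by (simp add: algebra_simps)
  moreover have "norm (center_exp n (rate_rem n)) \<le> 20 * center_exp n (\<lambda>y. 1 + \<bar>y\<bar> ^ 3)"
    by (rule norm_center_exp_bound) (unfold real_norm_def, rule rate_rem_bound[OF n])
  then have "\<bar>center_exp n (rate_rem n)\<bar> \<le> 20 * 10 ^ 9" using center_exp_cube(1)[OF n] by simp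
  moreover have "norm (center_exp n (\<lambda>y. drift_rem n y * y)) \<le> 20 * center_exp n (\<lambda>y. (1 + \<bar>y\<bar> ^ 3) * \<bar>y\<bar>)"
  proof (rule norm_center_exp_bound)
    fix y show "norm (drift_rem n y * y) \<le> 20 * ((1 + \<bar>y\<bar> ^ 3) * \<bar>y\<bar>)"
      using mult_right_mono[OF drift_rem_bound[OF n, of y], of "\<bar>y\<bar>"] by (simp add: abs_mult mult_ac)
  qed
  then have "\<bar>center_exp n (\<lambda>y. drift_rem n y * y)\<bar> \<le> 20 * 10 ^ 9" using center_exp_cube(2)[OF n] by simp
  ultimately have "\<bar>3 * center_exp n (rate_rem n) - center_exp n (\<lambda>y. drift_rem n y * y)\<bar> \<le> 80 * 10 ^ 9"
    by linarith
  from mult_left_mono[OF this u] show ?thesis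
    unfolding eq abs_mult abs_of_nonneg[OF u] by (simp only: u_def mult.commute)
qed

lemma tendsto_inverse_root_center: "(\<lambda>n. c * (1 / root_center n)) \<longlonglongrightarrow> 0"
proof -
  have "(\<lambda>n. 1 / root_center n) \<longlonglongrightarrow> 0"
    using root_center_at_top by (simp add: tendsto_inverse_0_at_top flip: inverse_eq_divide)
  then show ?thesis by (rule tendsto_mult_right_zero)
qed

lemma center_exp_mean_tendsto: "(\<lambda>n. center_exp n (\<lambda>y. y)) \<longlonglongrightarrow> 0"
  by (rule Lim_null_comparison[OF _ tendsto_inverse_root_center])
    (use center_exp_mean in \<open>auto intro!: eventually_mono[OF eventually_ge_at_top[of 3]]\<close>)

lemma center_exp_second_moment_tendsto: "(\<lambda>n. center_exp n (\<lambda>y. y\<^sup>2)) \<longlonglongrightarrow> 1"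
  by (rule Lim_null[THEN iffD2], rule Lim_null_comparison[OF _ tendsto_inverse_root_center])
    (use center_exp_second_moment in \<open>auto intro!: eventually_mono[OF eventually_ge_at_top[of 3]]\<close>)

section \<open>Convergence of the characteristic function\<close>

definition center_char :: "nat \<Rightarrow> real \<Rightarrow> complex" where
  "center_char n t = center_exp n (\<lambda>y. iexp (t * y))"

lemma has_vector_derivative_iexp_mult:
  "((\<lambda>t. iexp (t * y)) has_vector_derivative \<i> * complex_of_real y * iexp (t * y)) (at t within S)"
proof -
  have "((\<lambda>t. t * y) has_vector_derivative y) (at t within S)"
    by (auto intro!: derivative_eq_intros simp flip: has_real_derivative_iff_has_vector_derivative)
  from vector_diff_chain_within[OF this has_vector_derivative_iexp]
  show ?thesis by (simp add: o_def scaleR_conv_of_real mult_ac)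
qed

lemma has_vector_derivative_center_char:
  "(center_char n has_vector_derivative \<i> * center_exp n (\<lambda>y. y *\<^sub>R iexp (t * y))) (at t within S)"
proof -
  have "(center_char n has_vector_derivative center_exp n (\<lambda>y. \<i> * complex_of_real y * iexp (t * y))) (at t within S)"
    unfolding center_char_def[abs_def] center_exp_def type_exp_def
    by (intro has_vector_derivative_sum bounded_linear.has_vector_derivative[OF bounded_linear_scaleR_right] has_vector_derivative_iexp_mult)
  moreover have "center_exp n (\<lambda>y. \<i> * complex_of_real y * iexp (t * y)) = \<i> * center_exp n (\<lambda>y. y *\<^sub>R iexp (t * y))"
    by (simp add: mult.assoc scaleR_conv_of_real flip: center_exp_cmult)
  ultimately show ?thesis by simp
qed

text \<open>On exponentials the shift by 3/r is multiplication by a phase, so the difference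
  operator acts as the scalar c. Its third differs from i t by O(t^2/r), and the two remainders are
  paid for by the cubic moment bound.\<close>

lemma center_char_ode:
  assumes n: "n \<ge> 3"
  shows "cmod (center_exp n (\<lambda>y. y *\<^sub>R iexp (t * y)) - \<i> * t * center_char n t) \<le>
    10 ^ 11 * (1 + t\<^sup>2) * (1 / root_center n)"
proof -
  define r where "r = root_center n"
  define u where "u = 1 / r"
  have r: "r \<ge> 1" using root_center_ge_1[OF n] by (simp add: r_def)
  then have u: "0 \<le> u" by (simp add: u_def)
  have ur: "r * u = 1" using r by (simp add: u_def)
  define x where "x = - (3 * t * u)"
  define c where "c = complex_of_real r * (1 - iexp x)"
  have c1: "cmod c \<le> 3 * \<bar>t\<bar>"
  proof -
    have "cmod (iexp x - 1) \<le> \<bar>x\<bar>" using iexp_approx1[of x 0] by simp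
    then have "cmod c \<le> r * \<bar>x\<bar>" using r by (simp add: c_def norm_mult norm_minus_commute)
    also have "\<dots> = 3 * \<bar>t\<bar> * (r * u)" using u by (simp add: x_def abs_mult)
    finally show ?thesis using ur by simp
  qed
  have c2: "cmod (c / 3 - \<i> * t) \<le> 3 / 2 * t\<^sup>2 * u"
  proof -
    have "cmod (iexp x - (1 + \<i> * x)) \<le> x\<^sup>2 / 2"
      using iexp_approx1[of x 1] by (simp add: power2_eq_square)
    moreover have "c / 3 - \<i> * t = - (complex_of_real r / 3) * (iexp x - (1 + \<i> * x))"
    proof -
      have "complex_of_real r * complex_of_real u = 1" using ur by (metis of_real_1 of_real_mult)
      moreover have "complex_of_real x = - (3 * complex_of_real t * complex_of_real u)" by (simp add: x_def)
      ultimately show ?thesis using c_def by algebra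
    qed
    ultimately have "cmod (c / 3 - \<i> * t) \<le> r / 3 * (x\<^sup>2 / 2)"
      using r by (simp add: norm_mult mult_left_mono)
    also have "\<dots> = 3 / 2 * t\<^sup>2 * u * (r * u)" by (simp add: x_def power2_eq_square)
    finally show ?thesis using ur by simp
  qed
  define G where "G y = iexp (t * y)" for y
  have G: "((1 / 3 + u * rate_rem n y) * r) *\<^sub>R (G y - G (y - 3 / r)) = (complex_of_real (1 / 3 + u * rate_rem n y) * c) * G y" for y
  proof -
    have "t * (y - 3 / r) = t * y + x" by (simp add: x_def u_def algebra_simps)
    then have "G (y - 3 / r) = G y * iexp x" by (simp only: G_def of_real_add distrib_left exp_add)
    then show ?thesis by (simp add: c_def scaleR_conv_of_real algebra_simps)
  qed
  have "center_exp n (\<lambda>y. (y + u * drift_rem n y) *\<^sub>R G y) =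
    center_exp n (\<lambda>y. (complex_of_real (1 / 3 + u * rate_rem n y) * c) * G y)"
    using center_exp_stein[OF n, of G, folded r_def, folded u_def] unfolding G .
  then have A: "center_exp n (\<lambda>y. y *\<^sub>R G y) + center_exp n (\<lambda>y. (u * drift_rem n y) *\<^sub>R G y) =
    center_exp n (\<lambda>y. (complex_of_real (1 / 3 + u * rate_rem n y) * c) * G y)"
    by (simp only: center_exp_add scaleR_add_left)
  have "center_exp n (\<lambda>y. y *\<^sub>R G y) - \<i> * t * center_exp n G =
    center_exp n (\<lambda>y. (complex_of_real (1 / 3 + u * rate_rem n y) * c) * G y - (u * drift_rem n y) *\<^sub>R G y - \<i> * t * G y)"
    unfolding center_exp_diff center_exp_cmult A[symmetric] by simp
  moreover have "cmod (center_exp n (\<lambda>y. (complex_of_real (1 / 3 + u * rate_rem n y) * c) * G y - (u * drift_rem n y) *\<^sub>R G y - \<i> * t * G y)) \<le>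
    (u * (3 / 2 * t\<^sup>2 + 60 * \<bar>t\<bar> + 20)) * center_exp n (\<lambda>y. 1 + \<bar>y\<bar> ^ 3)"
  proof (rule norm_center_exp_bound)
    fix y
    have nG: "cmod (G y) = 1" by (simp add: G_def)
    have "(complex_of_real (1 / 3 + u * rate_rem n y) * c) * G y - (u * drift_rem n y) *\<^sub>R G y - \<i> * t * G y =
      ((c / 3 - \<i> * t) + complex_of_real (u * rate_rem n y) * c - complex_of_real (u * drift_rem n y)) * G y"
      unfolding scaleR_conv_of_real of_real_add of_real_divide of_real_1 of_real_numeral
      by (simp add: algebra_simps add_divide_distrib)
    then have "cmod ((complex_of_real (1 / 3 + u * rate_rem n y) * c) * G y - (u * drift_rem n y) *\<^sub>R G y - \<i> * t * G y) =
      cmod ((c / 3 - \<i> * t) + complex_of_real (u * rate_rem n y) * c - complex_of_real (u * drift_rem n y))"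
      by (simp add: norm_mult nG)
    also have "\<dots> \<le> cmod (c / 3 - \<i> * t) + cmod (complex_of_real (u * rate_rem n y) * c) + cmod (complex_of_real (u * drift_rem n y))"
      by (intro order_trans[OF norm_triangle_ineq4] add_right_mono norm_triangle_ineq)
    also have "\<dots> \<le> 3 / 2 * t\<^sup>2 * u * (1 + \<bar>y\<bar> ^ 3) + u * (20 * (1 + \<bar>y\<bar> ^ 3)) * (3 * \<bar>t\<bar>) + u * (20 * (1 + \<bar>y\<bar> ^ 3))"
    proof (intro add_mono)
      have "3 / 2 * t\<^sup>2 * u * 1 \<le> 3 / 2 * t\<^sup>2 * u * (1 + \<bar>y\<bar> ^ 3)" using u by (intro mult_left_mono) auto
      from order_trans[OF c2 this[unfolded mult_1_right]]
      show "cmod (c / 3 - \<i> * t) \<le> 3 / 2 * t\<^sup>2 * u * (1 + \<bar>y\<bar> ^ 3)" .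
      have "\<bar>u * rate_rem n y\<bar> \<le> u * (20 * (1 + \<bar>y\<bar> ^ 3))" 
        using u mult_left_mono[OF rate_rem_bound[OF n, of y] u] by (simp add: abs_mult)
      then show "cmod (complex_of_real (u * rate_rem n y) * c) \<le> u * (20 * (1 + \<bar>y\<bar> ^ 3)) * (3 * \<bar>t\<bar>)"
        unfolding norm_mult norm_of_real using c1 by (intro mult_mono) auto
      show "cmod (complex_of_real (u * drift_rem n y)) \<le> u * (20 * (1 + \<bar>y\<bar> ^ 3))"
        unfolding norm_of_real using u mult_left_mono[OF drift_rem_bound[OF n, of y] u] by (simp add: abs_mult)
    qed
    also have "\<dots> = u * (3 / 2 * t\<^sup>2 + 60 * \<bar>t\<bar> + 20) * (1 + \<bar>y\<bar> ^ 3)" by (simp add: algebra_simps)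
    finally show "cmod ((complex_of_real (1 / 3 + u * rate_rem n y) * c) * G y - (u * drift_rem n y) *\<^sub>R G y - \<i> * t * G y) \<le>
       u * (3 / 2 * t\<^sup>2 + 60 * \<bar>t\<bar> + 20) * (1 + \<bar>y\<bar> ^ 3)" .
  qed
  ultimately have "cmod (center_exp n (\<lambda>y. y *\<^sub>R G y) - \<i> * t * center_exp n G) \<le>
    (u * (3 / 2 * t\<^sup>2 + 60 * \<bar>t\<bar> + 20)) * center_exp n (\<lambda>y. 1 + \<bar>y\<bar> ^ 3)" by simp
  also have "\<dots> \<le> (u * (100 * (1 + t\<^sup>2))) * 10 ^ 9"
  proof (intro mult_mono center_exp_cube[OF n] mult_left_mono u)
    \<comment> \<open>The linear term in |t| is absorbed by 2|t| <= 1 + t^2; the resulting 100 times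
      the moment bound 10^9 gives 10^11.\<close>
    have "0 \<le> (\<bar>t\<bar> - 1)\<^sup>2" by simp
    then have "2 * \<bar>t\<bar> \<le> 1 + t\<^sup>2" by (simp add: power2_diff)
    moreover have "3 / 2 * w + 60 * a + 20 \<le> 100 * (1 + w)" if "2 * a \<le> 1 + w" "0 \<le> w" for a w :: real
      using that by (simp add: field_simps)
    ultimately show "3 / 2 * t\<^sup>2 + 60 * \<bar>t\<bar> + 20 \<le> 100 * (1 + t\<^sup>2)" using zero_le_power2[of t] by blast
    show "0 \<le> center_exp n (\<lambda>y. 1 + \<bar>y\<bar> ^ 3)"
      using center_exp_mono[of "\<lambda>_. 0 :: real" "\<lambda>y. 1 + \<bar>y\<bar> ^ 3" n] by simp
  qed (use u in auto)
  finally show ?thesis by (simp add: center_char_def G_def[abs_def] u_def r_def mult_ac)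
qed

text \<open>Integrating factor: exp(s^2/2) times the characteristic function starts at 1 and has a
  derivative of size O(1/r) on the interval of radius |t|, so the mean value inequality keeps it
  near 1. The symmetric interval treats both signs of t at once.\<close>

lemma center_char_bound:
  assumes n: "n \<ge> 3"
  shows "cmod (center_char n t - exp (- (t\<^sup>2) / 2)) \<le>
    (10 ^ 11 * (1 + t\<^sup>2) * exp (t\<^sup>2 / 2) * \<bar>t\<bar>) * (1 / root_center n)"
proof -
  define B where "B = 10 ^ 11 * (1 + t\<^sup>2) * exp (t\<^sup>2 / 2) * (1 / root_center n)"
  have r: "root_center n \<ge> 1" using root_center_ge_1[OF n] .
  then have B0: "B \<ge> 0" by (simp add: B_def)
  define F where "F s = exp (s\<^sup>2 / 2) *\<^sub>R center_char n s" for s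
  define D where "D s = exp (s\<^sup>2 / 2) *\<^sub>R (\<i> * (center_exp n (\<lambda>y. y *\<^sub>R iexp (s * y)) - \<i> * s * center_char n s))" for s
  have der: "(F has_vector_derivative D s) (at s within S)" for s S
  proof -
    have "((\<lambda>s. exp (s\<^sup>2 / 2)) has_real_derivative s * exp (s\<^sup>2 / 2)) (at s within S)"
      by (auto intro!: derivative_eq_intros)
    from has_vector_derivative_scaleR[OF this has_vector_derivative_center_char[of n s S]]
    show ?thesis unfolding F_def[abs_def] D_def
      by (rule has_vector_derivative_eq_rhs) (simp add: scaleR_conv_of_real algebra_simps)
  qed
  have nD: "cmod (D s) \<le> B" if "s \<in> cball 0 \<bar>t\<bar>" for s
  proof -
    have "\<bar>s\<bar> \<le> \<bar>t\<bar>" using that by simp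
    then have s: "s\<^sup>2 \<le> t\<^sup>2" by (simp add: abs_le_square_iff)
    have "cmod (D s) = exp (s\<^sup>2 / 2) * cmod (center_exp n (\<lambda>y. y *\<^sub>R iexp (s * y)) - \<i> * s * center_char n s)"
      unfolding D_def norm_scaleR norm_mult by simp
    also have "\<dots> \<le> exp (s\<^sup>2 / 2) * (10 ^ 11 * (1 + s\<^sup>2) * (1 / root_center n))"
      by (intro mult_left_mono center_char_ode[OF n]) simp
    also have "\<dots> \<le> exp (t\<^sup>2 / 2) * (10 ^ 11 * (1 + t\<^sup>2) * (1 / root_center n))"
      using s r by (intro mult_mono) auto
    finally show ?thesis by (simp add: B_def mult_ac)
  qed
  have "norm (F t - F 0) \<le> B * norm (t - 0)"
  proof (rule differentiable_bound[of "cball 0 \<bar>t\<bar>" F "\<lambda>s h. h *\<^sub>R D s"])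
    show "(F has_derivative (\<lambda>h. h *\<^sub>R D s)) (at s within cball 0 \<bar>t\<bar>)" for s
      using der[of s "cball 0 \<bar>t\<bar>"] by (simp add: has_vector_derivative_def)
    show "onorm (\<lambda>h. h *\<^sub>R D s) \<le> B" if "s \<in> cball 0 \<bar>t\<bar>" for s
      using nD[OF that] B0 by (intro onorm_bound) (auto simp: mult.commute[of B] mult_left_mono)
  qed auto
  moreover have "F 0 = 1" by (simp add: F_def center_char_def)
  ultimately have "cmod (F t - 1) \<le> B * \<bar>t\<bar>" by simp
  moreover have "center_char n t - exp (- (t\<^sup>2) / 2) = exp (- (t\<^sup>2) / 2) *\<^sub>R (F t - 1)"
    by (simp add: F_def scaleR_diff_right mult_exp_exp flip: scaleR_conv_of_real) (simp add: of_real_def exp_of_real)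
  moreover have "exp (- (t\<^sup>2) / 2) \<le> 1" by simp
  ultimately have "cmod (center_char n t - exp (- (t\<^sup>2) / 2)) \<le> 1 * (B * \<bar>t\<bar>)"
    using mult_mono[of "exp (- (t\<^sup>2) / 2)" 1 "cmod (F t - 1)" "B * \<bar>t\<bar>"] by simp
  then show ?thesis by (simp add: B_def mult_ac)
qed

lemma center_char_tendsto: "(\<lambda>n. center_char n t) \<longlonglongrightarrow> exp (- (t\<^sup>2) / 2)"
  by (rule Lim_null[THEN iffD2], rule Lim_null_comparison[OF _ tendsto_inverse_root_center])
    (use center_char_bound in \<open>auto intro!: eventually_mono[OF eventually_ge_at_top[of 3]]\<close>)

subsection \<open>Rarity of disconnected pairs\<close>

lemma convolution_sum_half:
  fixes f :: "nat \<Rightarrow> real"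
  assumes "\<And>b. b \<le> n \<Longrightarrow> f (n - b) = f b" "\<And>b. 0 \<le> f b"
  shows "(\<Sum>b = 1..<n. f b) \<le> 2 * (\<Sum>b = 1..n div 2. f b)"
proof -
  have "(\<Sum>b = 1..<n. f b) \<le> (\<Sum>b \<in> {1..n div 2} \<union> (\<lambda>b. n - b) ` {1..n div 2}. f b)"
  proof (rule sum_mono2)
    show "{1..<n} \<subseteq> {1..n div 2} \<union> (\<lambda>b. n - b) ` {1..n div 2}"
    proof
      fix b assume b: "b \<in> {1..<n}"
      show "b \<in> {1..n div 2} \<union> (\<lambda>b. n - b) ` {1..n div 2}"
      proof (cases "b \<le> n div 2")
        case False
        then have "b = n - (n - b)" "n - b \<in> {1..n div 2}" using b by auto
        then show ?thesis by blast
      qed (use b in auto)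
    qed
  qed (use assms in auto)
  also have "\<dots> \<le> (\<Sum>b \<in> {1..n div 2}. f b) + (\<Sum>b \<in> (\<lambda>b. n - b) ` {1..n div 2}. f b)"
    by (subst sum.union_inter[symmetric]) (auto intro!: sum_nonneg assms)
  also have "(\<Sum>b \<in> (\<lambda>b. n - b) ` {1..n div 2}. f b) = (\<Sum>b \<in> {1..n div 2}. f (n - b))"
    by (subst sum.reindex) (auto intro!: inj_onI)
  also have "\<dots> = (\<Sum>b \<in> {1..n div 2}. f b)" by (intro sum.cong refl assms) auto
  finally show ?thesis by simp
qed

(* U^3 grows like n! up to a geometric factor, so the terms of the convolution behave like
   (n choose b) powr (-1/3). *)
lemma convolution_quotient_tendsto_0:
  fixes U :: "nat \<Rightarrow> real"
  assumes pos: "\<And>n. U n > 0" and L: "L > 0"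
    and lim: "(\<lambda>n. (U (Suc n) / U n) ^ 3 / real (Suc n)) \<longlonglongrightarrow> L"
  shows "(\<lambda>n. \<Sum>b = 1..<n. U b * U (n - b) / U n) \<longlonglongrightarrow> 0"
proof -
  define V where "V n = U n ^ 3 / fact n" for n
  have Vpos: "V n > 0" for n using pos by (simp add: V_def)
  have V_Suc: "V (Suc n) = (U (Suc n) / U n) ^ 3 / real (Suc n) * V n" for n
    using pos[of n] by (simp add: V_def power_divide divide_simps del: of_nat_Suc)
  \<comment> \<open>The quotient of the two rates, (6/5)/(9/10) = 4/3, has to be less than 2: it is
    later multiplied by b/n <= 1/2, and the product must be a geometric ratio below 1.\<close>
  have "\<forall>\<^sub>F n in sequentially. (U (Suc n) / U n) ^ 3 / real (Suc n) < 6 / 5 * L"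
    using lim L by (intro order_tendstoD(2)) auto
  moreover have "\<forall>\<^sub>F n in sequentially. 9 / 10 * L < (U (Suc n) / U n) ^ 3 / real (Suc n)"
    using lim L by (intro order_tendstoD(1)) auto
  ultimately have "\<forall>\<^sub>F n in sequentially. (U (Suc n) / U n) ^ 3 / real (Suc n) < 6 / 5 * L \<and>
      9 / 10 * L < (U (Suc n) / U n) ^ 3 / real (Suc n)"
    by (rule eventually_conj)
  then obtain N where N: "\<And>n. n \<ge> N \<Longrightarrow> (U (Suc n) / U n) ^ 3 / real (Suc n) < 6 / 5 * L"
    "\<And>n. n \<ge> N \<Longrightarrow> 9 / 10 * L < (U (Suc n) / U n) ^ 3 / real (Suc n)"
    unfolding eventually_sequentially by blast
  have up: "V (Suc n) \<le> 6 / 5 * L * V n" and lo: "9 / 10 * L * V n \<le> V (Suc n)" if "n \<ge> N" for n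
    unfolding V_Suc using N[OF that] Vpos[of n] by (intro mult_right_mono; simp)+
  \<comment> \<open>Below N nothing is known about the growth; the sum dominates each of these
    finitely many normalised terms and so makes the upper bound hold from 0 on.\<close>
  define A where "A = (\<Sum>b \<le> N. V b / (6 / 5 * L) ^ b)"
  have A0: "A \<ge> 0" unfolding A_def using L Vpos by (intro sum_nonneg divide_nonneg_nonneg) (auto intro: less_imp_le)
  have VA: "V b \<le> A * (6 / 5 * L) ^ b" for b
  proof (induction b)
    case (Suc b)
    show ?case
    proof (cases "b \<ge> N")
      case True
      have "V (Suc b) \<le> 6 / 5 * L * V b" by (rule up[OF True])
      also have "\<dots> \<le> 6 / 5 * L * (A * (6 / 5 * L) ^ b)" using Suc L by (intro mult_left_mono) auto
      finally show ?thesis by (simp add: mult_ac)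
    next
      case False
      have "V (Suc b) / (6 / 5 * L) ^ Suc b \<le> A" unfolding A_def
        using False L Vpos by (intro member_le_sum divide_nonneg_nonneg) (auto intro: less_imp_le)
      then show ?thesis using L by (simp add: divide_le_eq del: power_Suc)
    qed
  next
    case 0
    have "V 0 / (6 / 5 * L) ^ 0 \<le> A" unfolding A_def
      using L Vpos by (intro member_le_sum divide_nonneg_nonneg) (auto intro: less_imp_le)
    then show ?case by simp
  qed
  have Vlow: "(9 / 10 * L) ^ j * V m \<le> V (m + j)" if "m \<ge> N" for m j
  proof (induction j)
    case (Suc j)
    have "(9 / 10 * L) ^ Suc j * V m = 9 / 10 * L * ((9 / 10 * L) ^ j * V m)" by simp
    also have "\<dots> \<le> 9 / 10 * L * V (m + j)" using Suc L by (intro mult_left_mono) auto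
    also have "\<dots> \<le> V (m + Suc j)" using lo[of "m + j"] that by simp
    finally show ?case .
  qed simp
  define \<tau> where "\<tau> n b = U b * U (n - b) / U n" for n b
  have \<tau>0: "\<tau> n b \<ge> 0" for n b using pos by (simp add: \<tau>_def less_imp_le)
  have bound: "\<tau> n b \<le> root 3 (24 * A / real n) * (9 / 10) ^ b" if b: "b \<ge> 1" "b \<le> n div 2" and n: "n \<ge> 2 * N" for n b
  proof -
    \<comment> \<open>Only the half b <= n/2 is treated, so n - b >= N and the lower growth rate
      holds on all the way from n - b to n.\<close>
    have bn: "b \<le> n" "n - b \<ge> N" "n > 0" "2 * b \<le> n" using b n by auto
    have "V n > 0" "V (n - b) > 0" by (rule Vpos)+
    have eq: "\<tau> n b ^ 3 = V b * (V (n - b) / V n) / real (n choose b)"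
      using pos bn by (simp add: \<tau>_def V_def binomial_fact power_divide power_mult_distrib field_simps)
    have "(9 / 10 * L) ^ b * V (n - b) \<le> V n" using Vlow[OF bn(2), of b] bn(1) by simp
    then have 1: "V (n - b) / V n \<le> 1 / (9 / 10 * L) ^ b" using L Vpos[of n] by (simp add: field_simps)
    have "(real n / real b) ^ b \<le> real (n choose b)" by (rule binomial_ge_n_over_k_pow_k[OF bn(1)])
    moreover have "(real n / real b) ^ b > 0" using b bn by simp
    ultimately have 2: "1 / real (n choose b) \<le> 1 / (real n / real b) ^ b" 
      by (intro divide_left_mono mult_pos_pos) (auto simp: bn)
    have "\<tau> n b ^ 3 = V b * (V (n - b) / V n) * (1 / real (n choose b))" by (simp add: eq)
    also have "\<dots> \<le> (A * (6 / 5 * L) ^ b) * (1 / (9 / 10 * L) ^ b) * (1 / (real n / real b) ^ b)"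
      using VA[of b] 1 2 Vpos[of n] Vpos[of "n - b"] Vpos[of b] L A0 b bn
      by (intro mult_mono) (auto intro!: mult_nonneg_nonneg divide_nonneg_nonneg intro: less_imp_le)
    also have "\<dots> = A * ((6 / 5 * L) * (1 / (9 / 10 * L)) * (1 / (real n / real b))) ^ b"
      by (simp only: power_mult_distrib power_one_over mult.assoc)
    also have "(6 / 5 * L) * (1 / (9 / 10 * L)) * (1 / (real n / real b)) = 4 / 3 * (real b / real n)" (is "_ = ?q")
      using L b bn by (simp add: field_simps)
    \<comment> \<open>One factor b/n is set aside before the ratio is bounded by 2/3: it supplies
      the 1/n that makes the sum vanish.\<close>
    also have "A * ?q ^ b = A * (?q * ?q ^ (b - 1))" using b by (simp add: power_eq_if)
    also have "\<dots> \<le> A * (?q * (2 / 3) ^ (b - 1))"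
    proof (intro mult_left_mono power_mono A0)
      have "2 * real b \<le> real n" using bn(4) by linarith
      then show "?q \<le> 2 / 3" using bn by (simp add: field_simps)
    qed auto
    also have "\<dots> = 2 * A / real n * (real b * (2 / 3) ^ b)" using b by (cases b) (simp_all add: field_simps)
    \<comment> \<open>The factor b is absorbed by a slightly larger ratio: 109/100 * 2/3 < (9/10)^3,
      and 12 exceeds 100/9 from Bernoulli. A cube is aimed at because the cube root must again be
      geometric.\<close>
    also have "\<dots> \<le> 2 * A / real n * (12 * (9 / 10) ^ (3 * b))"
    proof (intro mult_left_mono)
      have "1 + real b * (9 / 100) \<le> (1 + 9 / 100) ^ b" by (rule Bernoulli_inequality) simp
      then have "real b \<le> 12 * (109 / 100) ^ b" by simp
      then have "real b * (2 / 3) ^ b \<le> 12 * (109 / 100) ^ b * (2 / 3) ^ b" by (rule mult_right_mono) simp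
      also have "\<dots> = 12 * (109 / 100 * (2 / 3)) ^ b" by (simp only: power_mult_distrib mult.assoc)
      also have "\<dots> \<le> 12 * ((9 / 10) ^ 3) ^ b" by (intro mult_left_mono power_mono) (simp_all add: power3_eq_cube)
      finally show "real b * (2 / 3) ^ b \<le> 12 * (9 / 10) ^ (3 * b)" by (simp add: power_mult)
    qed (use A0 in simp)
    also have "\<dots> = (root 3 (24 * A / real n) * (9 / 10) ^ b) ^ 3"
      using A0 by (simp add: power_mult_distrib odd_real_root_pow flip: power_mult) (simp add: mult.commute)
    finally show ?thesis by (subst (asm) power_mono_iff) (use A0 \<tau>0 in auto)
  qed
  show ?thesis
  proof (rule Lim_null_comparison)
    show "\<forall>\<^sub>F n in sequentially. norm (\<Sum>b = 1..<n. U b * U (n - b) / U n) \<le> 20 * root 3 (24 * A / real n)"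
      using eventually_ge_at_top[of "2 * N"]
    proof eventually_elim
      case (elim n)
      have "(\<Sum>b = 1..<n. \<tau> n b) \<le> 2 * (\<Sum>b = 1..n div 2. \<tau> n b)"
        by (rule convolution_sum_half) (auto simp: \<tau>0, auto simp: \<tau>_def mult.commute)
      also have "(\<Sum>b = 1..n div 2. \<tau> n b) \<le> (\<Sum>b = 1..n div 2. root 3 (24 * A / real n) * (9 / 10) ^ b)"
        using elim by (intro sum_mono bound) auto
      also have "\<dots> \<le> root 3 (24 * A / real n) * 10"
      proof -
        have "(\<Sum>b = 1..n div 2. (9 / 10 :: real) ^ b) \<le> (\<Sum>b. (9 / 10) ^ b)"
          by (intro sum_le_suminf) (auto simp: summable_geometric)
        also have "\<dots> = 10" by (subst suminf_geometric) auto
        finally show ?thesis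
          using A0 by (simp add: mult_left_mono flip: sum_distrib_left)
      qed
      finally have "(\<Sum>b = 1..<n. \<tau> n b) \<le> 20 * root 3 (24 * A / real n)" by simp
      moreover have "0 \<le> (\<Sum>b = 1..<n. \<tau> n b)" by (intro sum_nonneg \<tau>0)
      ultimately show ?case by (simp add: \<tau>_def)
    qed
    show "(\<lambda>n. 20 * root 3 (24 * A / real n)) \<longlonglongrightarrow> 0"
    proof -
      have "(\<lambda>n. 24 * A / real n) \<longlonglongrightarrow> 0" by (rule lim_const_over_n)
      then have "(\<lambda>n. root 3 (24 * A / real n)) \<longlonglongrightarrow> root 3 0" by (rule tendsto_real_root)
      then show ?thesis by (intro tendsto_mult_right_zero) simp
    qed
  qed
qed

text \<open>Since k times the weight at k is half the weight at k - 1, averaging k over the types of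
  size n + 1 removes one 2-cycle and yields the total weight of size n. The mean is thus a ratio of
  consecutive totals and governs their growth.\<close>

lemma type_exp_id:
  "type_exp (Suc n) (\<lambda>k. k) = type_sum n / (2 * type_sum (Suc n))"
proof -
  \<comment> \<open>The range may gain one index, at which there are no 2-cycles, so the factor k
    makes the new term 0.\<close>
  have "(\<Sum>s \<le> Suc n div 3. cycle_weight (Suc n - 3 * s) (2 * s) * real (Suc n - 3 * s)) =
    (\<Sum>s \<le> n div 3. cycle_weight (Suc n - 3 * s) (2 * s) * real (Suc n - 3 * s))"
  proof (rule sum.mono_neutral_right)
    show "\<forall>s \<in> {..Suc n div 3} - {..n div 3}. cycle_weight (Suc n - 3 * s) (2 * s) * real (Suc n - 3 * s) = 0"
    proof
      fix s assume "s \<in> {..Suc n div 3} - {..n div 3}"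
      then have "Suc n - 3 * s = 0" by auto
      then show "cycle_weight (Suc n - 3 * s) (2 * s) * real (Suc n - 3 * s) = 0" by (simp only: of_nat_0 mult_zero_right)
    qed
  qed auto
  also have "\<dots> = (\<Sum>s \<le> n div 3. cycle_weight (n - 3 * s) (2 * s) / 2)"
  proof (rule sum.cong[OF refl])
    fix s assume "s \<in> {..n div 3}"
    then have "Suc n - 3 * s = Suc (n - 3 * s)" by auto
    then show "cycle_weight (Suc n - 3 * s) (2 * s) * real (Suc n - 3 * s) = cycle_weight (n - 3 * s) (2 * s) / 2"
      using cycle_weight_Suc(1)[of "n - 3 * s" "2 * s"] by simp
  qed
  also have "\<dots> = type_sum n / 2" by (simp add: type_sum_def flip: sum_divide_distrib)
  finally have "(\<Sum>s \<le> Suc n div 3. cycle_weight (Suc n - 3 * s) (2 * s) * real (Suc n - 3 * s)) = type_sum n / 2" .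
  moreover have "type_exp (Suc n) (\<lambda>k. k) =
      (\<Sum>s \<le> Suc n div 3. cycle_weight (Suc n - 3 * s) (2 * s) * real (Suc n - 3 * s)) / type_sum (Suc n)"
    unfolding type_exp_def sum_divide_distrib real_scaleR_def by (simp only: times_divide_eq_left)
  ultimately have "type_exp (Suc n) (\<lambda>k. k) = type_sum n / 2 / type_sum (Suc n)" by (simp only:)
  then show ?thesis by simp
qed

lemma type_exp_center:
  assumes "n \<ge> 1"
  shows "type_exp n G = center_exp n (\<lambda>y. G ((root_center n)\<^sup>2 + root_center n * y))"
  using root_center(1)[OF assms] by (simp add: center_exp_def)

lemma type_exp_id_center:
  assumes "n \<ge> 1"
  shows "type_exp n (\<lambda>k. k) = (root_center n)\<^sup>2 + root_center n * center_exp n (\<lambda>y. y)"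
  unfolding type_exp_center[OF assms] by (simp add: center_exp_add center_exp_cmult)

lemma pair_weight_ratio:
  "pair_weight (Suc n) / pair_weight n = (2 * real n + 1) / type_exp (Suc n) (\<lambda>k. k)"
proof -
  have "pair_weight (Suc n) = fact (2 * n) / fact n * (2 * (2 * real n + 1)) * type_sum (Suc n)"
  proof -
    have "fact (2 * Suc n) = 2 * real (Suc n) * (2 * real n + 1) * fact (2 * n)" by (simp add: algebra_simps)
    moreover have "fact (Suc n) = real (Suc n) * fact n" by simp
    ultimately show ?thesis by (simp add: pair_weight_def del: of_nat_Suc fact_Suc)
  qed
  then show ?thesis
    using type_sum_pos[of n] type_sum_pos[of "Suc n"] by (simp add: type_exp_id pair_weight_def field_simps)
qed

lemma type_exp_id_asymp: "(\<lambda>n. type_exp n (\<lambda>k. k) / (root_center n)\<^sup>2) \<longlonglongrightarrow> 1"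
proof -
  have "(\<lambda>n. 1 + 1 * (1 / root_center n) * center_exp n (\<lambda>y. y)) \<longlonglongrightarrow> 1 + 0 * 0"
    by (intro tendsto_intros center_exp_mean_tendsto tendsto_inverse_root_center)
  moreover have "\<forall>\<^sub>F n in sequentially. 1 + 1 * (1 / root_center n) * center_exp n (\<lambda>y. y) = type_exp n (\<lambda>k. k) / (root_center n)\<^sup>2"
    using eventually_ge_at_top[of 1]
  proof eventually_elim
    case (elim n)
    show ?case using root_center(1)[OF elim]
      by (simp add: type_exp_id_center[OF elim] add_divide_distrib power2_eq_square)
  qed
  ultimately show ?thesis using Lim_transform_eventually by fastforce
qed

lemma pair_weight_convolution_tendsto_0:
  "(\<lambda>n. \<Sum>b = 1..<n. pair_weight b * pair_weight (n - b) / pair_weight n) \<longlonglongrightarrow> 0"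
proof (rule convolution_quotient_tendsto_0[where L = 16])
  define \<rho> where "\<rho> n = type_exp n (\<lambda>k. k) / (root_center n)\<^sup>2" for n
  \<comment> \<open>At size N the ratio of weights is (2N - 1) divided by a mean asymptotic to r^2;
    its cube over N behaves like 8 N^2 / r^6, which tends to 8 * 2 = 16.\<close>
  have "(\<lambda>n. (2 - 1 / real n) ^ 3 * (center_ratio n)\<^sup>2 / \<rho> n ^ 3) \<longlonglongrightarrow> (2 - 0) ^ 3 * 2 / 1 ^ 3"
    unfolding \<rho>_def by (intro tendsto_intros center_ratio_tendsto type_exp_id_asymp lim_1_over_n) auto
  from LIMSEQ_Suc[OF this] have "(\<lambda>n. (2 - 1 / real (Suc n)) ^ 3 * (center_ratio (Suc n))\<^sup>2 / \<rho> (Suc n) ^ 3) \<longlonglongrightarrow> 16"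
    by (simp del: of_nat_Suc)
  moreover have "(2 - 1 / real (Suc n)) ^ 3 * (center_ratio (Suc n))\<^sup>2 / \<rho> (Suc n) ^ 3 =
    (pair_weight (Suc n) / pair_weight n) ^ 3 / real (Suc n)" for n
  proof -
    define r where "r = root_center (Suc n)"
    define E where "E = type_exp (Suc n) (\<lambda>k. k)"
    define N where "N = real (Suc n)"
    have N: "N > 0" "2 * real n + 1 = 2 * N - 1" by (simp_all add: N_def)
    have r: "r > 0" using root_center(1)[of "Suc n"] by (simp add: r_def)
    have E: "E > 0" using type_sum_pos[of n] type_sum_pos[of "Suc n"] by (simp add: E_def type_exp_id)
    have "(2 - 1 / N) ^ 3 * (N / r ^ 3)\<^sup>2 / (E / r\<^sup>2) ^ 3 = ((2 * N - 1) / E) ^ 3 / N"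
    proof -
      have "2 - 1 / N = (2 * N - 1) / N" using N by (simp add: field_simps)
      then show ?thesis using N r E by (simp add: field_simps flip: power_mult power_add) (simp add: power_numeral_reduce)
    qed
    then show ?thesis
      unfolding pair_weight_ratio N(2) \<rho>_def center_ratio_def r_def E_def N_def .
  qed
  ultimately show "(\<lambda>n. (pair_weight (Suc n) / pair_weight n) ^ 3 / real (Suc n)) \<longlonglongrightarrow> 16" by simp
qed (simp_all add: pair_weight_pos)

subsection \<open>Transfer to connected maps\<close>

definition map_pairs :: "nat \<Rightarrow> ((nat \<Rightarrow> nat) \<times> (nat \<Rightarrow> nat)) set" where
  "map_pairs n = perms23 {1..2 * n} \<times> matchings {1..2 * n}"

lemma finite_map_pairs: "finite (map_pairs n)"
  by (simp add: map_pairs_def finite_perms23 finite_matchings)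

lemma finite_connected_23_maps: "finite (connected_23_maps n)"
  using connected_23_maps_subset finite_map_pairs unfolding map_pairs_def by (rule finite_subset)

lemma card_map_pairs_pos: "card (map_pairs n) > 0"
proof -
  have "real (card (map_pairs n)) = fact (2 * n) / 2 ^ n * pair_weight n"
    using card_perms23_matchings[of "{1..2 * n}" n] by (simp add: map_pairs_def card_cartesian_product)
  also have "\<dots> > 0" using pair_weight_pos by simp
  finally show ?thesis by simp
qed

lemma X_bi_eq_num_cycles: "X_bi n (v, e) = real (num_cycles v {1..2 * n} 2)"
  by (simp add: X_bi_def bivalent_vertices_def num_cycles_def)

lemma sum_map_pairs:
  fixes g :: "real \<Rightarrow> 'b :: real_vector"
  shows "(\<Sum>m \<in> map_pairs n. g (X_bi n m)) = real (card (map_pairs n)) *\<^sub>R type_exp n g"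
proof -
  define A where "A = {1..2 * n}"
  have A: "finite A" "card A = 2 * n" by (simp_all add: A_def)
  have "(\<Sum>m \<in> map_pairs n. g (X_bi n m)) = (\<Sum>v \<in> perms23 A. \<Sum>e \<in> matchings A. g (real (num_cycles v A 2)))"
    unfolding map_pairs_def A_def by (subst sum.cartesian_product) (auto simp: X_bi_eq_num_cycles intro!: sum.cong)
  also have "\<dots> = real (card (matchings A)) *\<^sub>R (\<Sum>v \<in> perms23 A. g (real (num_cycles v A 2)))"
    by (simp add: sum_constant_scaleR scaleR_sum_right)
  also have "(\<Sum>v \<in> perms23 A. g (real (num_cycles v A 2))) =
    fact (2 * n) *\<^sub>R (\<Sum>s \<le> n div 3. cycle_weight (n - 3 * s) (2 * s) *\<^sub>R g (real (n - 3 * s)))"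
    by (rule sum_perms23[OF A])
  also have "(\<Sum>s \<le> n div 3. cycle_weight (n - 3 * s) (2 * s) *\<^sub>R g (real (n - 3 * s))) = type_sum n *\<^sub>R type_exp n g"
    using type_sum_pos[of n] by (simp add: type_exp_def scaleR_sum_right)
  finally show ?thesis
    unfolding map_pairs_def A_def[symmetric] card_cartesian_product of_nat_mult card_perms23[OF A]
    by (simp add: mult_ac)
qed

definition disconnected_prob :: "nat \<Rightarrow> real" where
  "disconnected_prob n = real (card (map_pairs n - connected_23_maps n)) / real (card (map_pairs n))"

lemma disconnected_prob_tendsto_0: "disconnected_prob \<longlonglongrightarrow> 0"
proof (rule Lim_null_comparison[OF always_eventually pair_weight_convolution_tendsto_0], rule allI)
  fix n
  show "norm (disconnected_prob n) \<le> (\<Sum>b = 1..<n. pair_weight b * pair_weight (n - b) / pair_weight n)"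
    using card_disconnected_le[of n] card_map_pairs_pos[of n]
    by (simp add: disconnected_prob_def map_pairs_def divide_le_eq)
qed

lemma card_connected_23_maps:
  "real (card (connected_23_maps n)) = (1 - disconnected_prob n) * real (card (map_pairs n))"
proof -
  have "card (map_pairs n - connected_23_maps n) = card (map_pairs n) - card (connected_23_maps n)"
    using connected_23_maps_subset by (intro card_Diff_subset finite_connected_23_maps) (simp add: map_pairs_def)
  moreover have "card (connected_23_maps n) \<le> card (map_pairs n)"
    using connected_23_maps_subset by (intro card_mono finite_map_pairs) (simp add: map_pairs_def)
  ultimately show ?thesis using card_map_pairs_pos[of n] by (simp add: disconnected_prob_def field_simps)
qed

definition centered_bi :: "nat \<Rightarrow> (nat \<Rightarrow> nat) \<times> (nat \<Rightarrow> nat) \<Rightarrow> real" where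
  "centered_bi n m = (X_bi n m - (root_center n)\<^sup>2) / root_center n"

text \<open>Divided by the number of all pairs, not of the disconnected ones: it is the contribution
  of disconnected pairs to \<open>center_exp\<close>, to be subtracted from it.\<close>

definition disconnected_part :: "nat \<Rightarrow> (real \<Rightarrow> 'b) \<Rightarrow> 'b :: real_vector" where
  "disconnected_part n g = (1 / real (card (map_pairs n))) *\<^sub>R
     (\<Sum>m \<in> map_pairs n - connected_23_maps n. g (centered_bi n m))"

definition connected_exp :: "nat \<Rightarrow> (real \<Rightarrow> 'b) \<Rightarrow> 'b :: real_vector" where
  "connected_exp n g = (1 / real (card (connected_23_maps n))) *\<^sub>R
     (\<Sum>m \<in> connected_23_maps n. g (centered_bi n m))"

lemma sum_map_pairs_centered:
  "(\<Sum>m \<in> map_pairs n. g (centered_bi n m)) = real (card (map_pairs n)) *\<^sub>R center_exp n g"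
  unfolding centered_bi_def center_exp_def by (rule sum_map_pairs)

text \<open>If all pairs were disconnected, both sides would be 0 because division by 0 gives 0;
  hence the equation carries no nonemptiness condition.\<close>

lemma connected_exp_eq:
  "connected_exp n g = (1 / (1 - disconnected_prob n)) *\<^sub>R (center_exp n g - disconnected_part n g)"
proof -
  let ?c = "real (card (map_pairs n))"
  have "(\<Sum>m \<in> map_pairs n - connected_23_maps n. g (centered_bi n m)) =
      ?c *\<^sub>R center_exp n g - (\<Sum>m \<in> connected_23_maps n. g (centered_bi n m))"
    unfolding sum_map_pairs_centered[symmetric]
    using connected_23_maps_subset by (intro sum_diff finite_map_pairs) (simp add: map_pairs_def)
  then have "(\<Sum>m \<in> connected_23_maps n. g (centered_bi n m)) = ?c *\<^sub>R center_exp n g - ?c *\<^sub>R disconnected_part n g"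
    using card_map_pairs_pos[of n] by (simp add: disconnected_part_def)
  then show ?thesis
    using card_map_pairs_pos[of n] unfolding connected_exp_def card_connected_23_maps
    by (simp flip: scaleR_diff_right)
qed

text \<open>Cauchy--Schwarz against the indicator of the disconnected pairs bounds the contribution
  by the square root of their probability times a second moment of g. For g(y) = y^2 that is the
  fourth moment.\<close>

lemma disconnected_part_tendsto_0:
  fixes g :: "real \<Rightarrow> 'b :: real_normed_vector"
  assumes "\<And>n. n \<ge> 3 \<Longrightarrow> center_exp n (\<lambda>y. (norm (g y))\<^sup>2) \<le> C"
  shows "(\<lambda>n. disconnected_part n g) \<longlonglongrightarrow> 0"
proof (rule Lim_null_comparison)
  show "(\<lambda>n. sqrt (disconnected_prob n * C)) \<longlonglongrightarrow> 0"
    using tendsto_real_sqrt[OF tendsto_mult_left_zero[OF disconnected_prob_tendsto_0, of C]] by simp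
  show "\<forall>\<^sub>F n in sequentially. norm (disconnected_part n g) \<le> sqrt (disconnected_prob n * C)"
    using eventually_ge_at_top[of 3]
  proof eventually_elim
    case (elim n)
    let ?B = "map_pairs n - connected_23_maps n"
    let ?c = "real (card (map_pairs n))"
    have c: "?c > 0" using card_map_pairs_pos[of n] by simp
    define S where "S = (\<Sum>m \<in> ?B. norm (g (centered_bi n m)))"
    have S0: "S \<ge> 0" by (simp add: S_def sum_nonneg)
    have "S\<^sup>2 \<le> (\<Sum>m \<in> ?B. 1\<^sup>2) * (\<Sum>m \<in> ?B. (norm (g (centered_bi n m)))\<^sup>2)"
      using Cauchy_Schwarz_ineq_sum[of "\<lambda>_. 1" "\<lambda>m. norm (g (centered_bi n m))" ?B] by (simp add: S_def)
    also have "\<dots> \<le> real (card ?B) * (\<Sum>m \<in> map_pairs n. (norm (g (centered_bi n m)))\<^sup>2)"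
      using finite_map_pairs by (simp, intro mult_left_mono sum_mono2) auto
    also have "\<dots> = real (card ?B) * (?c * center_exp n (\<lambda>y. (norm (g y))\<^sup>2))"
      using sum_map_pairs_centered[of "\<lambda>y. (norm (g y))\<^sup>2" n] by simp
    also have "\<dots> \<le> real (card ?B) * (?c * C)"
      using assms[OF elim] by (intro mult_left_mono) auto
    finally have "S\<^sup>2 / ?c\<^sup>2 \<le> real (card ?B) * (?c * C) / ?c\<^sup>2" by (rule divide_right_mono) simp
    also have "\<dots> = disconnected_prob n * C" using c by (simp add: disconnected_prob_def power2_eq_square)
    finally have "S / ?c \<le> sqrt (disconnected_prob n * C)"
      by (intro real_le_rsqrt) (simp add: power_divide)
    moreover have "norm (disconnected_part n g) \<le> S / ?c"
      using c by (simp add: disconnected_part_def S_def divide_right_mono norm_sum)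
    ultimately show ?case by simp
  qed
qed

lemma connected_exp_tendsto:
  fixes g :: "real \<Rightarrow> 'b :: real_normed_vector"
  assumes "\<And>n. n \<ge> 3 \<Longrightarrow> center_exp n (\<lambda>y. (norm (g y))\<^sup>2) \<le> C"
    and "(\<lambda>n. center_exp n g) \<longlonglongrightarrow> l"
  shows "(\<lambda>n. connected_exp n g) \<longlonglongrightarrow> l"
proof -
  have "(\<lambda>n. disconnected_part n g) \<longlonglongrightarrow> 0" by (rule disconnected_part_tendsto_0[OF assms(1)])
  then have "(\<lambda>n. (1 / (1 - disconnected_prob n)) *\<^sub>R (center_exp n g - disconnected_part n g)) \<longlonglongrightarrow> (1 / (1 - 0)) *\<^sub>R (l - 0)"
    by (intro tendsto_intros disconnected_prob_tendsto_0 assms(2)) auto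
  then show ?thesis by (simp add: connected_exp_eq)
qed

lemma connected_exp_mean: "(\<lambda>n. connected_exp n (\<lambda>y. y)) \<longlonglongrightarrow> 0"
proof (rule connected_exp_tendsto[OF _ center_exp_mean_tendsto])
  fix n :: nat assume n: "n \<ge> 3"
  have "(norm y)\<^sup>2 \<le> 1 + y ^ 4" for y :: real
  proof -
    have "2 * y\<^sup>2 \<le> 1 + y ^ 4"
      using zero_le_power2[of "y\<^sup>2 - 1"] by (simp add: power2_diff flip: power_mult)
    moreover have "0 \<le> y\<^sup>2" by simp
    ultimately have "y\<^sup>2 \<le> 1 + y ^ 4" by linarith
    then show ?thesis by simp
  qed
  then have "center_exp n (\<lambda>y :: real. (norm y)\<^sup>2) \<le> center_exp n (\<lambda>y. 1 + y ^ 4)" by (rule center_exp_mono)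
  then show "center_exp n (\<lambda>y :: real. (norm y)\<^sup>2) \<le> 10 ^ 9"
    using center_exp_fourth_moment[OF n] by (simp add: center_exp_add)
qed

lemma connected_exp_square: "(\<lambda>n. connected_exp n (\<lambda>y. y\<^sup>2)) \<longlonglongrightarrow> 1"
  by (rule connected_exp_tendsto[OF _ center_exp_second_moment_tendsto, of "2 * 10 ^ 8"])
    (use center_exp_fourth_moment in \<open>simp flip: power_mult\<close>)

lemma connected_exp_iexp: "(\<lambda>n. connected_exp n (\<lambda>y. iexp (t * y))) \<longlonglongrightarrow> exp (- (t\<^sup>2) / 2)"
  by (rule connected_exp_tendsto[of _ 1]) (use center_char_tendsto[of t] in \<open>simp_all add: center_char_def\<close>)

lemma connected_23_maps_nonempty: "\<forall>\<^sub>F n in sequentially. connected_23_maps n \<noteq> {}"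
proof -
  have "\<forall>\<^sub>F n in sequentially. disconnected_prob n < 1"
    by (rule order_tendstoD(2)[OF disconnected_prob_tendsto_0]) simp
  then show ?thesis
  proof eventually_elim
    case (elim n)
    then have "real (card (connected_23_maps n)) > 0"
      unfolding card_connected_23_maps using card_map_pairs_pos[of n] by simp
    then show ?case by auto
  qed
qed

section \<open>Mean, variance and limit law of the random connected map\<close>

lemma integral_random_map:
  fixes f :: "(nat \<Rightarrow> nat) \<times> (nat \<Rightarrow> nat) \<Rightarrow> 'b :: {banach, second_countable_topology}"
  assumes "connected_23_maps n \<noteq> {}"
  shows "(LINT m|random_map n. f m) =
    (1 / real (card (connected_23_maps n))) *\<^sub>R (\<Sum>m \<in> connected_23_maps n. f m)"
  unfolding random_map_def
  by (subst integral_measure_pmf[OF finite_connected_23_maps])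
    (use assms finite_connected_23_maps in \<open>auto simp: scaleR_sum_right\<close>)

lemma integral_random_map_centered:
  fixes g :: "real \<Rightarrow> 'b :: {banach, second_countable_topology}"
  assumes "connected_23_maps n \<noteq> {}"
  shows "(LINT m|random_map n. g (centered_bi n m)) = connected_exp n g"
  by (simp add: integral_random_map[OF assms] connected_exp_def)

lemma integrable_random_map:
  fixes f :: "(nat \<Rightarrow> nat) \<times> (nat \<Rightarrow> nat) \<Rightarrow> 'b :: {banach, second_countable_topology}"
  assumes "connected_23_maps n \<noteq> {}"
  shows "integrable (random_map n) f"
  using assms finite_connected_23_maps
  by (intro integrable_measure_pmf_finite) (simp add: random_map_def)

definition centered_variance :: "nat \<Rightarrow> real" where
  "centered_variance n = connected_exp n (\<lambda>y. y\<^sup>2) - (connected_exp n (\<lambda>y. y))\<^sup>2"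

lemma centered_variance_tendsto: "centered_variance \<longlonglongrightarrow> 1"
proof -
  have "(\<lambda>n. connected_exp n (\<lambda>y. y\<^sup>2) - (connected_exp n (\<lambda>y. y))\<^sup>2) \<longlonglongrightarrow> 1 - 0\<^sup>2"
    by (intro tendsto_intros connected_exp_square connected_exp_mean)
  then show ?thesis by (simp add: centered_variance_def[abs_def])
qed

lemma mean_bi_eq:
  assumes ne: "connected_23_maps n \<noteq> {}" and n: "n \<ge> 1"
  shows "mean_bi n = (root_center n)\<^sup>2 + root_center n * connected_exp n (\<lambda>y. y)"
proof -
  have X: "X_bi n = (\<lambda>m. (root_center n)\<^sup>2 + root_center n * centered_bi n m)"
    using root_center(1)[OF n] by (simp add: centered_bi_def fun_eq_iff)
  have int: "integrable (random_map n) (centered_bi n)" by (rule integrable_random_map[OF ne])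
  have "mean_bi n = measure_pmf.expectation (random_map n) (\<lambda>m. (root_center n)\<^sup>2 + root_center n * centered_bi n m)"
    unfolding mean_bi_def by (subst X) (rule refl)
  also have "\<dots> = (root_center n)\<^sup>2 + root_center n * measure_pmf.expectation (random_map n) (centered_bi n)"
    using int by (simp add: measure_pmf.prob_space)
  finally show ?thesis using integral_random_map_centered[OF ne, of "\<lambda>y. y"] by simp
qed

lemma X_bi_minus_mean:
  assumes ne: "connected_23_maps n \<noteq> {}" and n: "n \<ge> 1"
  shows "X_bi n m - mean_bi n = root_center n * (centered_bi n m - connected_exp n (\<lambda>y. y))"
  unfolding mean_bi_eq[OF assms] using root_center(1)[OF n] by (simp add: centered_bi_def field_simps power2_eq_square)

lemma variance_bi_eq:
  assumes ne: "connected_23_maps n \<noteq> {}" and n: "n \<ge> 1"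
  shows "variance_bi n = (root_center n)\<^sup>2 * centered_variance n"
proof -
  let ?\<mu> = "connected_exp n (\<lambda>y. y)"
  have int: "integrable (random_map n) (centered_bi n)" "integrable (random_map n) (\<lambda>m. (centered_bi n m)\<^sup>2)"
    by (rule integrable_random_map[OF ne])+
  have "variance_bi n = measure_pmf.expectation (random_map n) (\<lambda>m. (root_center n * (centered_bi n m - ?\<mu>))\<^sup>2)"
    unfolding variance_bi_def using X_bi_minus_mean[OF assms] by (simp add: mean_bi_def)
  also have "\<dots> = measure_pmf.expectation (random_map n)
      (\<lambda>m. (root_center n)\<^sup>2 * ((centered_bi n m)\<^sup>2 - 2 * ?\<mu> * centered_bi n m + ?\<mu>\<^sup>2))"
    by (intro Bochner_Integration.integral_cong refl) (simp add: power2_eq_square algebra_simps)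
  also have "\<dots> = (root_center n)\<^sup>2 * (measure_pmf.expectation (random_map n) (\<lambda>m. (centered_bi n m)\<^sup>2)
      - 2 * ?\<mu> * measure_pmf.expectation (random_map n) (\<lambda>m. centered_bi n m) + ?\<mu>\<^sup>2)"
    using int by (simp add: measure_pmf.prob_space)
  finally show ?thesis
    using integral_random_map_centered[OF ne, of "\<lambda>y. y"] integral_random_map_centered[OF ne, of "\<lambda>y. y\<^sup>2"]
    by (simp add: centered_variance_def power2_eq_square)
qed

text \<open>From n = v r^3 one gets (2n)^(2/3) = (4 v^2)^(1/3) r^2, and v^2 tends to 2, so the
  factor tends to 8^(1/3) = 2.\<close>

lemma root_center_sq_asymp: "(\<lambda>n. (root_center n)\<^sup>2) \<sim>[at_top] (\<lambda>n. (2 * real n) powr (2 / 3) / 2)"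
proof (rule asymp_equiv_symI, rule asymp_equivI')
  have "(\<lambda>n. (4 * (center_ratio n)\<^sup>2) powr (1 / 3) / 2) \<longlonglongrightarrow> (4 * 2) powr (1 / 3) / 2"
    by (intro tendsto_intros center_ratio_tendsto) auto
  also have "(4 * 2 :: real) powr (1 / 3) = 2"
  proof -
    have "(4 * 2 :: real) = 2 powr 3" by simp
    then show ?thesis by (simp only: powr_powr) simp
  qed
  finally have "(\<lambda>n. (4 * (center_ratio n)\<^sup>2) powr (1 / 3) / 2) \<longlonglongrightarrow> 1" by simp
  moreover have "\<forall>\<^sub>F n in sequentially. (4 * (center_ratio n)\<^sup>2) powr (1 / 3) / 2 =
      (2 * real n) powr (2 / 3) / 2 / (root_center n)\<^sup>2"
    using eventually_ge_at_top[of 3]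
  proof eventually_elim
    case (elim n)
    have r: "root_center n > 0" using root_center(1) elim by simp
    have "(2 * real n) powr (2 / 3) = ((2 * real n) powr 2) powr (1 / 3)" by (subst powr_powr) simp
    also have "(2 * real n) powr 2 = (2 * real n)\<^sup>2" using elim by simp
    also have "\<dots> = (4 * (center_ratio n)\<^sup>2) * root_center n powr 6"
      using r by (subst center_ratio(1)[OF elim]) (simp add: power_mult_distrib flip: power_mult)
    also have "\<dots> powr (1 / 3) = (4 * (center_ratio n)\<^sup>2) powr (1 / 3) * (root_center n powr 6) powr (1 / 3)"
      by (rule powr_mult)
    also have "(root_center n powr 6) powr (1 / 3) = (root_center n)\<^sup>2"
      using r by (subst powr_powr) simp
    finally show ?case using r by simp
  qed
  ultimately show "(\<lambda>n. (2 * real n) powr (2 / 3) / 2 / (root_center n)\<^sup>2) \<longlonglongrightarrow> 1"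
    by (rule Lim_transform_eventually)
qed

lemma mean_bi_asymp: "mean_bi \<sim>[at_top] (\<lambda>n. (root_center n)\<^sup>2)"
proof (rule asymp_equivI')
  have "(\<lambda>n. 1 + (1 * (1 / root_center n)) * connected_exp n (\<lambda>y. y)) \<longlonglongrightarrow> 1 + 0 * 0"
    by (intro tendsto_intros connected_exp_mean tendsto_inverse_root_center)
  moreover have "\<forall>\<^sub>F n in sequentially. 1 + (1 * (1 / root_center n)) * connected_exp n (\<lambda>y. y) = mean_bi n / (root_center n)\<^sup>2"
    using eventually_ge_at_top[of 1] connected_23_maps_nonempty
  proof eventually_elim
    case (elim n)
    then show ?case using root_center(1)[of n] by (simp add: mean_bi_eq add_divide_distrib power2_eq_square)
  qed
  ultimately show "(\<lambda>n. mean_bi n / (root_center n)\<^sup>2) \<longlonglongrightarrow> 1"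
    using Lim_transform_eventually by fastforce
qed

lemma variance_bi_asymp: "variance_bi \<sim>[at_top] (\<lambda>n. (root_center n)\<^sup>2)"
proof (rule asymp_equivI', rule Lim_transform_eventually[OF centered_variance_tendsto])
  show "\<forall>\<^sub>F n in sequentially. centered_variance n = variance_bi n / (root_center n)\<^sup>2"
    using eventually_ge_at_top[of 1] connected_23_maps_nonempty
  proof eventually_elim
    case (elim n)
    then show ?case using root_center(1)[of n] by (simp add: variance_bi_eq)
  qed
qed

lemma iexp_diff_le: "cmod (iexp a - iexp b) \<le> \<bar>a - b\<bar>"
proof -
  have "iexp a = iexp b * iexp (a - b)" by (simp add: algebra_simps flip: exp_add)
  then have "iexp a - iexp b = iexp b * (iexp (a - b) - 1)" by (simp only: right_diff_distrib mult_1_right)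
  then have "cmod (iexp a - iexp b) = cmod (iexp (a - b) - 1)" by (simp add: norm_mult)
  also have "\<dots> \<le> \<bar>a - b\<bar>" using iexp_approx1[of "a - b" 0] by simp
  finally show ?thesis .
qed

text \<open>A Slutsky argument for characteristic functions: \<open>iexp\<close> is 1-Lipschitz, so
  the change is at most |t| (|a - 1| E|Y| + |b|), and E|Y| stays bounded with the second moment. It
  passes from centring at r^2 and scaling by r to the true mean and standard deviation.\<close>

lemma connected_exp_iexp_affine:
  assumes a: "a \<longlonglongrightarrow> 1" and b: "b \<longlonglongrightarrow> 0"
  shows "(\<lambda>n. connected_exp n (\<lambda>y. iexp (t * (a n * y + b n)))) \<longlonglongrightarrow> exp (- (t\<^sup>2) / 2)"
proof (rule Lim_transform2[OF connected_exp_iexp], rule Lim_null_comparison)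
  have "(\<lambda>n. \<bar>t\<bar> * (\<bar>a n - 1\<bar> * (1 + connected_exp n (\<lambda>y. y\<^sup>2)) + \<bar>b n\<bar>)) \<longlonglongrightarrow> \<bar>t\<bar> * (\<bar>1 - 1\<bar> * (1 + 1) + \<bar>0\<bar>)"
    by (intro tendsto_intros a b connected_exp_square)
  then show "(\<lambda>n. \<bar>t\<bar> * (\<bar>a n - 1\<bar> * (1 + connected_exp n (\<lambda>y. y\<^sup>2)) + \<bar>b n\<bar>)) \<longlonglongrightarrow> 0" by simp
  show "\<forall>\<^sub>F n in sequentially. norm (connected_exp n (\<lambda>y. iexp (t * y)) - connected_exp n (\<lambda>y. iexp (t * (a n * y + b n)))) \<le>
    \<bar>t\<bar> * (\<bar>a n - 1\<bar> * (1 + connected_exp n (\<lambda>y. y\<^sup>2)) + \<bar>b n\<bar>)"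
    using connected_23_maps_nonempty
  proof eventually_elim
    case (elim n)
    let ?D = "connected_23_maps n" and ?Y = "centered_bi n"
    let ?c = "real (card ?D)"
    have c: "?c > 0" using elim finite_connected_23_maps by (simp add: card_gt_0_iff)
    have pw: "cmod (iexp (t * y) - iexp (t * (a n * y + b n))) \<le> \<bar>t\<bar> * (\<bar>a n - 1\<bar> * (1 + y\<^sup>2) + \<bar>b n\<bar>)" for y
    proof -
      have "0 \<le> (\<bar>y\<bar> - 1)\<^sup>2" by simp
      then have "2 * \<bar>y\<bar> \<le> 1 + y\<^sup>2" by (simp add: power2_diff)
      then have y: "\<bar>y\<bar> \<le> 1 + y\<^sup>2" using zero_le_power2[of y] by linarith
      have "cmod (iexp (t * y) - iexp (t * (a n * y + b n))) \<le> \<bar>t * y - t * (a n * y + b n)\<bar>" by (rule iexp_diff_le)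
      also have "\<dots> = \<bar>t\<bar> * \<bar>(a n - 1) * y + b n\<bar>" by (simp add: algebra_simps flip: abs_mult)
      also have "\<dots> \<le> \<bar>t\<bar> * (\<bar>a n - 1\<bar> * \<bar>y\<bar> + \<bar>b n\<bar>)"
        by (intro mult_left_mono) (simp_all add: abs_triangle_ineq flip: abs_mult)
      also have "\<dots> \<le> \<bar>t\<bar> * (\<bar>a n - 1\<bar> * (1 + y\<^sup>2) + \<bar>b n\<bar>)"
        using y by (intro mult_left_mono add_right_mono) auto
      finally show ?thesis .
    qed
    have "norm (connected_exp n (\<lambda>y. iexp (t * y)) - connected_exp n (\<lambda>y. iexp (t * (a n * y + b n)))) =
      norm (\<Sum>m \<in> ?D. iexp (t * ?Y m) - iexp (t * (a n * ?Y m + b n))) / ?c"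
      using c by (simp add: connected_exp_def sum_subtractf flip: scaleR_diff_right)
    also have "\<dots> \<le> (\<Sum>m \<in> ?D. \<bar>t\<bar> * (\<bar>a n - 1\<bar> * (1 + (?Y m)\<^sup>2) + \<bar>b n\<bar>)) / ?c"
      by (intro divide_right_mono sum_norm_le pw) simp
    also have "\<dots> = \<bar>t\<bar> * (\<bar>a n - 1\<bar> * (1 + connected_exp n (\<lambda>y. y\<^sup>2)) + \<bar>b n\<bar>)"
      using c by (simp add: connected_exp_def sum.distrib divide_simps flip: sum_distrib_left)
    finally show ?case .
  qed
qed

lemma char_normalized_bi:
  "(\<lambda>n. char (distr (measure_pmf (random_map n)) borel (normalized_bi n)) t) \<longlonglongrightarrow> exp (- (t\<^sup>2) / 2)"
proof -
  define s where "s n = sqrt (centered_variance n)" for n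
  define \<mu> where "\<mu> n = connected_exp n (\<lambda>y. y)" for n
  have s: "s \<longlonglongrightarrow> 1"
    using tendsto_real_sqrt[OF centered_variance_tendsto] by (simp add: s_def[abs_def])
  have "(\<lambda>n. 1 / s n) \<longlonglongrightarrow> 1 / 1" "(\<lambda>n. - \<mu> n / s n) \<longlonglongrightarrow> - 0 / 1"
    unfolding \<mu>_def by (intro tendsto_intros s connected_exp_mean; simp)+
  then have "(\<lambda>n. connected_exp n (\<lambda>y. iexp (t * (1 / s n * y + - \<mu> n / s n)))) \<longlonglongrightarrow> exp (- (t\<^sup>2) / 2)"
    by (intro connected_exp_iexp_affine) simp_all
  moreover have "\<forall>\<^sub>F n in sequentially. connected_exp n (\<lambda>y. iexp (t * (1 / s n * y + - \<mu> n / s n))) =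
      char (distr (measure_pmf (random_map n)) borel (normalized_bi n)) t"
    using eventually_ge_at_top[of 1] connected_23_maps_nonempty
  proof eventually_elim
    case (elim n)
    have r: "root_center n > 0" using root_center(1) elim by simp
    have "normalized_bi n m = 1 / s n * centered_bi n m + - \<mu> n / s n" for m
      unfolding normalized_bi_def X_bi_minus_mean[OF elim(2,1)] variance_bi_eq[OF elim(2,1)]
      using r by (simp add: real_sqrt_mult s_def \<mu>_def diff_divide_distrib)
    moreover have "char (distr (measure_pmf (random_map n)) borel (normalized_bi n)) t =
      (CLINT m|random_map n. iexp (t * normalized_bi n m))"
      unfolding char_def by (rule integral_distr) simp_all
    ultimately show ?case
      using integral_random_map_centered[OF elim(2), of "\<lambda>y. iexp (t * (1 / s n * y + - \<mu> n / s n))"] by simp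
  qed
  ultimately show ?thesis by (rule Lim_transform_eventually)
qed

theorem mainTheorem4:
  shows "mean_bi \<sim>[at_top] (\<lambda>n. (2 * real n) powr (2 / 3) / 2)
       \<and> variance_bi \<sim>[at_top] (\<lambda>n. (2 * real n) powr (2 / 3) / 2)
       \<and> weak_conv_m (\<lambda>n. distr (measure_pmf (random_map n)) borel (normalized_bi n))
           std_normal_distribution"
proof (intro conjI)
  show "mean_bi \<sim>[at_top] (\<lambda>n. (2 * real n) powr (2 / 3) / 2)"
    by (rule asymp_equiv_trans[OF mean_bi_asymp root_center_sq_asymp])
  show "variance_bi \<sim>[at_top] (\<lambda>n. (2 * real n) powr (2 / 3) / 2)"
    by (rule asymp_equiv_trans[OF variance_bi_asymp root_center_sq_asymp])
  show "weak_conv_m (\<lambda>n. distr (measure_pmf (random_map n)) borel (normalized_bi n)) std_normal_distribution"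
  proof (rule levy_continuity)
    show "real_distribution (distr (measure_pmf (random_map n)) borel (normalized_bi n))" for n
      by (intro prob_space.real_distribution_distr[OF prob_space_measure_pmf]) simp
    show "real_distribution std_normal_distribution" by (rule real_dist_normal_dist)
    show "(\<lambda>n. char (distr (measure_pmf (random_map n)) borel (normalized_bi n)) t) \<longlonglongrightarrow>
        char std_normal_distribution t" for t
      using char_normalized_bi[of t] by (simp add: char_std_normal_distribution)
  qed
qed

end
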